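(* Let $k$ be a positive integer. If $k$ is odd, or if $k$ is even with $k<2p$, then \[H_k^0:=\{\xi\in L(b')^{k+1}:\ a\tfrac{d\xi}{da}-\xi G_k=0\}=0.\]
   Context: Let $p\ge5$ be prime, $\mathrm{ord}$ the $p$-adic valuation on $\mathbb{C}_p$ with $\mathrm{ord}(p)=1$, and $\pi\in\mathbb{C}_p$ with $\pi^{p-1}=-p$. Let $b,b'$ be reals with $\frac{p-1}{p}\ge b>\frac1{p-1}$ and $\frac bp\ge b'>0$. Let $L(b')$ be the ring of series $\sum_{i\ge0}B_ia^i$ ($B_i\in\mathbb{C}_p$) with $\mathrm{ord}(B_i)\ge\frac{2b'}{3}i+\rho$ for all $i$, for some $\rho\in\mathbb{R}$. Elements of $L(b')^{k+1}$ are row vectors $\xi=(\xi_1,\ldots,\xi_{k+1})$ (coordinates of an element of the $k$-th symmetric power of the rank-two module with basis $v=x$, $w=x^2$, with respect to the ordered basis $v^k,v^{k-1}w,\ldots,w^k$). $G_k$ is the $(k+1)\times(k+1)$ matrix with entries $(G_k)_{i,i+1}=(k-i+1)\pi a$ for $1\le i\le k$, $(G_k)_{i+1,i}=-\frac{i\pi a^2}{3}$ for $1\le i\le k$, and all other entries $0$. The operator $\partial_a$ acts on row vectors by $\xi\mapsto a\frac{d\xi}{da}-\xi G_k$. *)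

theory Defs
  imports
    "HOL-Computational_Algebra.Computational_Algebra"
    "HOL-Library.Extended_Real"
    "Jordan_Normal_Form.Matrix"
begin

text \<open>
  Valuations are written additively, with values in \<^typ>\<open>ereal\<close> and with value \<^term>\<open>\<infinity> :: ereal\<close>
  exactly at zero. Large valuation means close to zero, so the topology, Cauchy sequences, limits
  and closures below are those of the absolute value \<open>p powr (- ord x)\<close>.
\<close>

definition valuation_closure :: "('a::field \<Rightarrow> ereal) \<Rightarrow> 'a set \<Rightarrow> 'a set" where
  "valuation_closure ord A = {x. \<forall>M::real. \<exists>y\<in>A. ord (x - y) \<ge> ereal M}"

definition valuation_Cauchy :: "('a::field \<Rightarrow> ereal) \<Rightarrow> (nat \<Rightarrow> 'a) \<Rightarrow> bool" where
  "valuation_Cauchy ord s \<longleftrightarrow> (\<forall>M::real. \<exists>N. \<forall>m\<ge>N. \<forall>n\<ge>N. ord (s m - s n) \<ge> ereal M)"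

definition valuation_limit :: "('a::field \<Rightarrow> ereal) \<Rightarrow> (nat \<Rightarrow> 'a) \<Rightarrow> 'a \<Rightarrow> bool" where
  "valuation_limit ord s l \<longleftrightarrow> (\<forall>M::real. \<exists>N. \<forall>n\<ge>N. ord (s n - l) \<ge> ereal M)"

definition poly_over :: "'a::field set \<Rightarrow> 'a poly \<Rightarrow> bool" where
  "poly_over K f \<longleftrightarrow> (\<forall>i. coeff f i \<in> K)"

definition algebraic_elements :: "'a::field set \<Rightarrow> 'a set" where
  "algebraic_elements K = {x. \<exists>f. f \<noteq> 0 \<and> poly_over K f \<and> poly f x = 0}"

text \<open>
  The type \<open>'a\<close> with the valuation \<open>ord\<close> is (a copy of) the field of \<open>p\<close>-adic complex numbers:
  the completion of an algebraic closure of the completion of the rationals. As \<open>'a\<close> is complete,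
  the closure of the rationals in it is their completion, the field of \<open>p\<close>-adic numbers. That
  \<open>ord\<close> restricts to the \<open>p\<close>-adic valuation on the rationals follows from \<open>ord_p\<close> and the
  valuation axioms, and its restriction to the algebraic numbers over the \<open>p\<close>-adic
  field is then determined. Hence a model is unique up to an isomorphism that preserves \<open>ord\<close>.
\<close>

locale padic_complex_field =
  fixes p :: nat and ord :: "'a::field_char_0 \<Rightarrow> ereal"
  assumes prime_p: "prime p"
    and ord_not_MInf: "ord x \<noteq> -\<infinity>"
    and ord_eq_PInf_iff: "ord x = \<infinity> \<longleftrightarrow> x = 0"
    and ord_mult: "ord (x * y) = ord x + ord y"
    and ord_add: "ord (x + y) \<ge> min (ord x) (ord y)"
    and ord_p: "ord (of_nat p) = 1"
    and complete: "valuation_Cauchy ord s \<Longrightarrow> \<exists>l. valuation_limit ord s l"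
    and algebraic_closure:
      "\<lbrakk>poly_over (algebraic_elements (valuation_closure ord \<rat>)) f; degree f > 0\<rbrakk> \<Longrightarrow>
        \<exists>x\<in>algebraic_elements (valuation_closure ord \<rat>). poly f x = 0"
    and algebraic_dense:
      "valuation_closure ord (algebraic_elements (valuation_closure ord \<rat>)) = UNIV"

definition L_ring :: "('a::field \<Rightarrow> ereal) \<Rightarrow> real \<Rightarrow> 'a fps set" where
  "L_ring ord b' =
    {B. \<exists>\<rho>::real. \<forall>i. ord (fps_nth B i) \<ge> ereal (2 * b' / 3 * real i + \<rho>)}"

text \<open>
  The variable \<open>a\<close> is \<^const>\<open>fps_X\<close>. Rows and columns are numbered from \<open>0\<close>, so the
  entry \<open>(i, i + 1)\<close> of the usual numbering is \<open>(r, r + 1)\<close> with \<open>r = i - 1\<close>, and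
  \<open>(i + 1, i)\<close> is \<open>(r, r - 1)\<close> with \<open>r = i\<close>.
\<close>

definition G_mat :: "'a::field \<Rightarrow> nat \<Rightarrow> 'a fps mat" where
  "G_mat \<pi> k = mat (k + 1) (k + 1) (\<lambda>(r, c).
     if c = r + 1 then fps_const (of_nat (k - r) * \<pi>) * fps_X
     else if r = c + 1 then - (fps_const (of_nat r * \<pi> / 3) * fps_X ^ 2)
     else 0)"

text \<open>The product of the row vector \<open>\<xi>\<close> and the matrix \<open>G\<close> is the column product of the transpose.\<close>

definition partial_a :: "'a::field \<Rightarrow> nat \<Rightarrow> 'a fps vec \<Rightarrow> 'a fps vec" where
  "partial_a \<pi> k \<xi> =
     map_vec (\<lambda>f. fps_X * fps_deriv f) \<xi> - transpose_mat (G_mat \<pi> k) *\<^sub>v \<xi>"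

definition H0 :: "('a::field \<Rightarrow> ereal) \<Rightarrow> 'a \<Rightarrow> real \<Rightarrow> nat \<Rightarrow> 'a fps vec set" where
  "H0 ord \<pi> b' k =
     {\<xi> \<in> carrier_vec (k + 1). (\<forall>j<k + 1. vec_index \<xi> j \<in> L_ring ord b') \<and>
        partial_a \<pi> k \<xi> = 0\<^sub>v (k + 1)}"

end

theory Submission
  imports Defs "HOL-Number_Theory.Cong"
begin

text \<open>
  The row vector \<open>\<xi>\<close> is a binary form \<open>F(X, Y) = \<Sum>c. \<xi>\<^sub>c X\<^bsup>k-c\<^esup> Y\<^bsup>c\<^esup>\<close>, and it is horizontal iff \<open>F\<close> is constant
  along the solutions of \<open>X' = - \<pi> Y\<close>, \<open>Y' = (\<pi> a / 3) X\<close>, that is, of the Airy equation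
  \<open>X'' = - (\<pi>\<^sup>2 a / 3) X\<close>. At infinity, with \<open>a = T\<^sup>2\<close>, the two solutions are \<open>T powr (-1/2) * exp (\<plusminus>\<mu> T\<^sup>3)\<close>
  times asymptotic series in \<open>1 / T\<^sup>3\<close>, whose coefficients grow \<open>p\<close>-adically slower than any
  exponential. These series therefore act on the coefficients of \<open>\<xi>\<close>, which decay exponentially.
  In the resulting coordinates the equation decouples into
  \<open>(2 n - k) g(n) = - 6 \<mu> (k - 2 j) g(n - 3)\<close>, where \<open>ord (g(n)) \<ge> e n + \<rho>\<close> for all integers \<open>n\<close>.
  If \<open>p\<close> does not divide \<open>k - 2 j\<close>, iterating upwards violates this bound; if \<open>p\<close> divides it and \<open>k\<close> is
  odd, iterating downwards does. For \<open>k = 2 j\<close> only \<open>g(j)\<close> can be nonzero, and then the last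
  coordinate of \<open>\<xi>\<close> would be \<open>T\<^bsup>j-k\<^esup>\<close> times a power series in \<open>1 / T\<^sup>3\<close> with nonzero constant term,
  which is not a power series in \<open>a\<close>.
\<close>

subsection \<open>Factorials and arithmetic progressions\<close>

lemma coprime_6_prime:
  assumes "prime p" and "p \<ge> (5::nat)"
  shows "coprime 6 (int p)"
proof -
  have "coprime p (2 * 3)"
    using assms primes_coprime[OF assms(1) two_is_prime_nat] primes_coprime[OF assms(1), of 3]
    unfolding coprime_mult_right_iff by auto
  then have "coprime 6 p" by (simp add: coprime_commute)
  then show ?thesis by (metis coprime_int_iff of_nat_numeral)
qed

text \<open>The quotient is a binomial coefficient: multiplied by D! the product becomes (D + j)!,
  which j! D! divides.\<close>

lemma fact_dvd_rising_product: "fact j dvd (\<Prod>i<j. D + 1 + i :: nat)"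
proof -
  have "fact D * (\<Prod>i<j. D + 1 + i) = (fact (j + D) :: nat)"
    by (induction j) (auto simp: algebra_simps)
  then show ?thesis
    using fact_fact_dvd_fact[of j D, where ?'a = nat] by (metis dvd_times_left_cancel_iff fact_nonzero mult.commute)
qed

text \<open>Modulo a number coprime to \<open>c\<close> the progression can be rescaled to consecutive integers.\<close>

lemma dvd_progression_product:
  fixes c d :: int and q :: nat
  assumes "coprime c (int q)" and "q dvd fact j" and "q > 0"
  shows "int q dvd (\<Prod>i<j. c * int i + d)"
proof -
  obtain c' where c': "[c * c' = 1] (mod int q)"
    using cong_solve_coprime_int[OF assms(1)] by blast
  define D where "D = nat ((c' * d - 1) mod int q)"
  have D: "[int D + 1 = c' * d] (mod int q)"
    using assms(3) by (simp add: D_def cong_def mod_simps)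
  have "[(\<Prod>i<j. c * int i + d) = (\<Prod>i<j. c * (int i + (int D + 1)))] (mod int q)"
  proof (rule cong_prod)
    fix i
    have "[c * (int i + (int D + 1)) = c * (int i + c' * d)] (mod int q)"
      by (intro cong_mult cong_add D) auto
    also have "c * (int i + c' * d) = c * int i + (c * c') * d" by (simp add: algebra_simps)
    also have "[\<dots> = c * int i + 1 * d] (mod int q)"
      by (intro cong_mult cong_add c') auto
    finally show "[c * int i + d = c * (int i + (int D + 1))] (mod int q)"
      by (simp add: cong_sym_eq)
  qed
  also have "(\<Prod>i<j. c * (int i + (int D + 1))) = c ^ j * int (\<Prod>i<j. D + 1 + i)"
    by (simp add: prod.distrib add_ac)
  finally have "[(\<Prod>i<j. c * int i + d) = c ^ j * int (\<Prod>i<j. D + 1 + i)] (mod int q)" .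
  moreover have "int q dvd int (\<Prod>i<j. D + 1 + i)"
    using assms(2) fact_dvd_rising_product[of j D] dvd_trans int_dvd_int_iff by blast
  ultimately show ?thesis
    using cong_dvd_iff dvd_mult by blast
qed

section \<open>Legendre-type lower bound for the exponent of p in factorials\<close>

lemma power_mult_fact_dvd_fact:
  assumes "p > 0"
  shows "p ^ m * fact m dvd (fact (p * m) :: nat)"
proof (induction m)
  case (Suc m)
  have "p ^ Suc m * fact (Suc m) = (p ^ m * fact m) * (p * Suc m)"
    by (simp only: fact_Suc power_Suc mult_ac) simp
  also have "\<dots> dvd fact (p * m) * (p * Suc m)"
    using Suc by (intro mult_dvd_mono) auto
  also have "\<dots> dvd fact (p * m + (p - 1)) * (p * Suc m)"
    by (intro mult_dvd_mono fact_dvd) auto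
  also have "p * Suc m = Suc (p * m + (p - 1))" using assms by simp
  also have "fact (p * m + (p - 1)) * Suc (p * m + (p - 1)) = fact (Suc (p * m + (p - 1)))"
    by (simp only: fact_Suc mult.commute of_nat_id)
  also have "Suc (p * m + (p - 1)) = p * Suc m" using assms by simp
  finally show ?case .
qed simp

text \<open>The multiples of p up to j contribute p^m m! with m = j div p. This is one round of
  Legendre's formula.\<close>

lemma multiplicity_fact_ge:
  assumes "prime p"
  shows "multiplicity p (fact j :: nat) \<ge> j div p + multiplicity p (fact (j div p) :: nat)"
proof -
  let ?m = "j div p"
  have "multiplicity p (p ^ ?m * fact ?m :: nat) \<le> multiplicity p (fact j :: nat)"
    using prime_gt_0_nat[OF assms]
    by (intro dvd_imp_multiplicity_le dvd_trans[OF power_mult_fact_dvd_fact] fact_dvd) auto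
  moreover have "multiplicity p (p ^ ?m * fact ?m :: nat) = ?m + multiplicity p (fact ?m :: nat)"
    using assms by (subst prime_elem_multiplicity_mult_distrib) (auto simp: prime_gt_0_nat)
  ultimately show ?thesis by simp
qed

text \<open>Legendre's formula falls short of j / (p - 1) only by a logarithmic error, which the
  slack \<open>\<delta> * real j\<close> absorbs.\<close>

lemma multiplicity_fact_lower_bound:
  assumes p: "prime p" and "\<delta> > 0"
  shows "\<exists>C. \<forall>j. real (multiplicity p (fact j :: nat)) \<ge> real j / (real p - 1) - \<delta> * real j - C"
proof (intro exI allI)
  fix j
  have p2: "real p \<ge> 2" using prime_ge_2_nat[OF p] by simp
  \<comment> \<open>The constant 2 / \<delta> settles all j up to 2 / \<delta>, where the bound is
    nonpositive. Beyond that, the descent from j to m = j div p loses 1, and m \<le> j / 2 gives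
    \<delta> (j - m) > 1.\<close>
  show "real (multiplicity p (fact j :: nat)) \<ge> real j / (real p - 1) - \<delta> * real j - 2 / \<delta>"
  proof (induction j rule: less_induct)
    case (less j)
    show ?case
    proof (cases "real j \<le> 2 / \<delta>")
      case True
      have "real j / (real p - 1) \<le> real j"
        using p2 by (simp add: field_simps mult_left_mono)
      moreover have "\<delta> * real j \<ge> 0" using assms by simp
      ultimately show ?thesis using True by linarith
    next
      case False
      then have j: "\<delta> * real j > 2" using \<open>\<delta> > 0\<close> by (simp add: field_simps)
      then have "j > 0" using \<open>\<delta> > 0\<close> by (cases j) auto
      define m where "m = j div p"
      have "m < j" using \<open>j > 0\<close> p prime_gt_1_nat by (simp add: m_def)
      have m2: "2 * m \<le> j"
        using mult_le_mono1[OF prime_ge_2_nat[OF p], of m] times_div_less_eq_dividend[of p j]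
      unfolding m_def by linarith
      have "j \<le> p * m + (p - 1)"
        using p prime_gt_0_nat[OF p] mod_less_divisor[of p j] mult_div_mod_eq[of p j]
        unfolding m_def by linarith
      then have jm: "real j \<le> real p * real m + (real p - 1)"
        using prime_gt_0_nat[OF p] by (metis of_nat_1 of_nat_add of_nat_diff of_nat_le_iff of_nat_mult Suc_leI One_nat_def)
      have "real j / (real p - 1) \<le> (real p * real m + (real p - 1)) / (real p - 1)"
        using jm p2 by (intro divide_right_mono) auto
      also have "\<dots> = real m + real m / (real p - 1) + 1"
        using p2 by (simp add: field_simps)
      finally have 1: "real j / (real p - 1) \<le> real m + real m / (real p - 1) + 1" .
      have 2: "real m + real (multiplicity p (fact m :: nat)) \<le> real (multiplicity p (fact j :: nat))"
        using multiplicity_fact_ge[OF p, of j] unfolding m_def by linarith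
      have 3: "real (multiplicity p (fact m :: nat)) \<ge> real m / (real p - 1) - \<delta> * real m - 2 / \<delta>"
        by (rule less[OF \<open>m < j\<close>])
      have "\<delta> * (2 * real m) \<le> \<delta> * real j"
        using m2 \<open>\<delta> > 0\<close> by (intro mult_left_mono) auto
      then show ?thesis using 1 2 3 j by linarith
    qed
  qed
qed

section \<open>Upper bound for the exponent of p along progressions of step 6\<close>

lemma card_progression_multiples_le:
  fixes r :: int
  assumes "coprime c (int q)" and "q > 0"
  shows "card {l. l < i \<and> int q dvd r - c * int l} \<le> i div q + 1"
proof -
  \<comment> \<open>As c is invertible mod q, all these l lie in one residue class, so each block of
    q consecutive integers contains at most one of them.\<close>
  have "inj_on (\<lambda>l. l div q) {l. l < i \<and> int q dvd r - c * int l}"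
  proof (rule inj_onI, clarsimp)
    fix x y assume d: "int q dvd r - c * int x" "int q dvd r - c * int y" and e: "x div q = y div q"
    have "int q dvd c * (int x - int y)"
      using dvd_diff[OF d(2) d(1)] by (simp add: algebra_simps)
    then have "int q dvd int x - int y"
      using assms(1) by (simp add: coprime_dvd_mult_right_iff coprime_commute)
    then have "[int x = int y] (mod int q)" by (simp add: cong_iff_dvd_diff)
    then have "x mod q = y mod q" by (metis cong_def cong_int_iff)
    then show "x = y" using e by (metis mult_div_mod_eq)
  qed
  moreover have "(\<lambda>l. l div q) ` {l. l < i \<and> int q dvd r - c * int l} \<subseteq> {..i div q}"
    by (auto intro: div_le_mono)
  ultimately show ?thesis
    by (metis card_inj_on_le card_atMost finite_atMost Suc_eq_plus1)
qed

text \<open>If m is the multiplicity, then p, ..., p^m all divide x, and the size bound keeps m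
  within N. In this form multiplicities can be summed by double counting.\<close>

lemma multiplicity_le_card:
  fixes x :: int
  assumes "prime p" and "x \<noteq> 0" and "\<bar>x\<bar> < int p ^ Suc N"
  shows "multiplicity (int p) x \<le> card {j \<in> {1..N}. int (p ^ j) dvd x}"
proof -
  let ?m = "multiplicity (int p) x"
  have "?m \<le> N"
  proof (rule ccontr)
    assume "\<not> ?m \<le> N"
    then have "int p ^ Suc N dvd x" by (intro multiplicity_dvd') simp
    then show False using zdvd_imp_le[of "int p ^ Suc N" "\<bar>x\<bar>"] assms by auto
  qed
  then have "{1..?m} \<subseteq> {j \<in> {1..N}. int (p ^ j) dvd x}"
    by (auto intro: multiplicity_dvd')
  from card_mono[OF _ this] show ?thesis by simp
qed

lemma sum_inverse_powers_le:
  assumes "q > (1::real)"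
  shows "(\<Sum>j=1..N. 1 / q ^ j) \<le> 1 / (q - 1)"
proof -
  have "(\<Sum>j=1..N. 1 / q ^ j) = (1 - 1 / q ^ N) / (q - 1)"
  proof (induction N)
    case (Suc N)
    have "(1 - 1 / q ^ N) / (q - 1) + 1 / q ^ Suc N = (1 - 1 / q ^ Suc N) / (q - 1)"
      using assms by (simp add: divide_simps) (simp add: algebra_simps)
    then show ?case using Suc by simp
  qed simp
  also have "\<dots> \<le> 1 / (q - 1)" using assms by (intro divide_right_mono) auto
  finally show ?thesis .
qed

text \<open>The number \<open>N\<close> of relevant powers of \<open>p\<close> is only logarithmic in \<open>i\<close>, but \<open>i / 4\<close> suffices.\<close>

lemma multiplicity_progression_upper_bound:
  fixes r :: int
  assumes p: "prime p" "p \<ge> 5" and nz: "\<And>l. l < i \<Longrightarrow> r - 6 * int l \<noteq> 0"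
  shows "(\<Sum>l<i. real (multiplicity (int p) (r - 6 * int l)))
    \<le> real i / (real p - 1) + real i / 4 + \<bar>real_of_int r\<bar> + 3"
proof -
  define R where "R = nat \<bar>r\<bar>"
  define N where "N = i div 4 + R + 2"
  have six: "coprime (6::int) (int (p ^ j))" for j
    using coprime_6_prime[OF p] by simp
  have small: "\<bar>r - 6 * int l\<bar> < int p ^ Suc N" if "l < i" for l
  proof -
    have pow: "n < (5::nat) ^ n" for n by (induction n) auto
    \<comment> \<open>A crude estimate: n < 5^n is applied to R and to i div 4, and 125 = 5^3
      supplies the rest of the exponent N + 1.\<close>
    have "R + 6 * i < 125 * ((R + 1) * (i div 4 + 1))"
      using div_mult_mod_eq[of i 4] mod_less_divisor[of 4 i] by (simp add: algebra_simps)
    also have "\<dots> \<le> 125 * (5 ^ R * 5 ^ (i div 4))"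
      by (intro mult_left_mono mult_mono) (use pow in \<open>auto simp: Suc_le_eq\<close>)
    also have "\<dots> = 5 ^ Suc N" by (simp add: N_def power_add)
    also have "\<dots> \<le> p ^ Suc N" using p(2) by (rule power_mono) simp
    finally have "int (R + 6 * i) < int p ^ Suc N" by (metis of_nat_less_iff of_nat_power)
    then show ?thesis using that by (simp add: R_def)
  qed
  \<comment> \<open>Double counting of the pairs (l, j) with p^j dividing r - 6 l.\<close>
  have "(\<Sum>l<i. multiplicity (int p) (r - 6 * int l)) \<le>
      (\<Sum>l<i. card {j \<in> {1..N}. int (p ^ j) dvd r - 6 * int l})"
    by (intro sum_mono multiplicity_le_card p nz small) auto
  also have "\<dots> = (\<Sum>j=1..N. card {l \<in> {..<i}. int (p ^ j) dvd r - 6 * int l})"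
    by (rule sum_multicount_gen) auto
  also have "\<dots> \<le> (\<Sum>j=1..N. i div p ^ j + 1)"
  proof (rule sum_mono)
    fix j
    have "card {l. l < i \<and> int (p ^ j) dvd r - 6 * int l} \<le> i div p ^ j + 1"
      using prime_gt_0_nat[OF p(1)] by (intro card_progression_multiples_le six) simp
    then show "card {l \<in> {..<i}. int (p ^ j) dvd r - 6 * int l} \<le> i div p ^ j + 1"
      by (simp only: lessThan_iff)
  qed
  also have "\<dots> = (\<Sum>j=1..N. i div p ^ j) + N" by (subst sum.distrib) simp
  finally have "real (\<Sum>l<i. multiplicity (int p) (r - 6 * int l)) \<le>
      real ((\<Sum>j=1..N. i div p ^ j) + N)"
    by (simp only: of_nat_le_iff)
  then have "(\<Sum>l<i. real (multiplicity (int p) (r - 6 * int l))) \<le>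
      (\<Sum>j=1..N. real (i div p ^ j)) + real N"
    by (simp only: of_nat_add of_nat_sum)
  also have "(\<Sum>j=1..N. real (i div p ^ j)) \<le> (\<Sum>j=1..N. real i * (1 / real p ^ j))"
    by (intro sum_mono) (metis mult.right_neutral of_nat_div_le_of_nat of_nat_power times_divide_eq_right)
  also have "\<dots> \<le> real i * (1 / (real p - 1))"
    unfolding sum_distrib_left[symmetric] using p(2)
    by (intro mult_left_mono sum_inverse_powers_le) auto
  also have "real N \<le> real i / 4 + \<bar>real_of_int r\<bar> + 3"
    using of_nat_div_le_of_nat[where 'a = real, of i 4] by (simp add: N_def R_def)
  finally show ?thesis by simp
qed

subsection \<open>Valuations\<close>

context padic_complex_field
begin

text \<open>At zero the real value is the default 0, so bounds meant to include zero are phrased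
  with \<open>vge\<close>.\<close>

definition val :: "'a \<Rightarrow> real" where "val x = real_of_ereal (ord x)"

definition vge :: "'a \<Rightarrow> real \<Rightarrow> bool" where "vge x c \<longleftrightarrow> ord x \<ge> ereal c"

lemma ord_eq_val: "x \<noteq> 0 \<Longrightarrow> ord x = ereal (val x)"
  using ord_not_MInf[of x] ord_eq_PInf_iff[of x] by (cases "ord x") (auto simp: val_def)

lemma vge_iff: "vge x c \<longleftrightarrow> x = 0 \<or> val x \<ge> c"
  using ord_eq_val[of x] ord_eq_PInf_iff[of x] by (cases "x = 0") (auto simp: vge_def)

lemma val_mult: "x \<noteq> 0 \<Longrightarrow> y \<noteq> 0 \<Longrightarrow> val (x * y) = val x + val y"
  using ord_mult[of x y] by (simp add: ord_eq_val)

lemma val_one [simp]: "val 1 = 0"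
  using val_mult[of 1 1] by simp

lemma val_power: "x \<noteq> 0 \<Longrightarrow> val (x ^ n) = real n * val x"
  by (induction n) (auto simp: val_mult algebra_simps)

lemma val_minus [simp]: "val (- x) = val x"
proof (cases "x = 0")
  case False
  have "val ((-1) ^ 2) = 2 * val (-1)" by (subst val_power) auto
  then have "val (-1) = 0" by simp
  then show ?thesis using val_mult[of "-1" x] False by simp
qed simp

lemma val_inverse: "x \<noteq> 0 \<Longrightarrow> val (inverse x) = - val x"
  using val_mult[of x "inverse x"] by simp

lemma val_prod: "(\<And>i. i \<in> A \<Longrightarrow> f i \<noteq> 0) \<Longrightarrow> val (prod f A) = (\<Sum>i\<in>A. val (f i))"
  by (induction A rule: infinite_finite_induct) (auto simp: val_mult)

lemma vge_zero [simp]: "vge 0 c" by (simp add: vge_iff)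

lemma vge_mono: "vge x c \<Longrightarrow> d \<le> c \<Longrightarrow> vge x d" by (auto simp: vge_iff)

lemma vge_minus [simp]: "vge (- x) c \<longleftrightarrow> vge x c" by (simp add: vge_iff)

lemma vge_add: "vge x c \<Longrightarrow> vge y c \<Longrightarrow> vge (x + y) c"
  using ord_add[of x y] unfolding vge_def by (metis min_def order_trans)

lemma vge_diff: "vge x c \<Longrightarrow> vge y c \<Longrightarrow> vge (x - y) c"
  using vge_add[of x c "- y"] by simp

lemma vge_mult: "vge x c \<Longrightarrow> vge y d \<Longrightarrow> vge (x * y) (c + d)"
  by (cases "x = 0 \<or> y = 0") (auto simp: vge_iff val_mult)

lemma vge_sum: "(\<And>i. i \<in> A \<Longrightarrow> vge (f i) c) \<Longrightarrow> vge (sum f A) c"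
  by (induction A rule: infinite_finite_induct) (auto simp: vge_add)

lemma eq_zero_if_vge: "(\<And>c. vge x c) \<Longrightarrow> x = 0"
  by (metis gt_ex not_le vge_iff)

lemma vge_of_nat: "vge (of_nat n) 0"
  by (induction n) (auto intro!: vge_add simp: vge_iff[of 1])

lemma vge_of_int: "vge (of_int m) 0"
  by (cases m rule: int_cases2) (auto simp: vge_of_nat)

lemma val_p: "val (of_nat p) = 1"
  using ord_p by (simp add: val_def)

text \<open>Bezout: if m had positive valuation, so would 1 = x m + y p.\<close>

lemma val_of_int_coprime:
  assumes "coprime m (int p)" and "m \<noteq> 0"
  shows "val (of_int m) = 0"
proof (rule ccontr)
  assume "val (of_int m) \<noteq> 0"
  with vge_of_int[of m] assms have pos: "val (of_int m) > 0" by (auto simp: vge_iff)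
  define c where "c = min (val (of_int m)) 1"
  obtain x y where xy: "x * m + y * int p = 1"
    using assms(1) by (metis bezout_int coprime_iff_gcd_eq_1 mult.commute)
  have "vge (of_int x * of_int m) (0 + c)" "vge (of_int y * of_nat p) (0 + c)"
    by (intro vge_mult vge_of_int; simp add: vge_iff c_def val_p)+
  then have "vge (of_int x * of_int m + of_int y * of_nat p) c"
    by (simp add: vge_add)
  also have "of_int x * of_int m + of_int y * of_nat p = (of_int (x * m + y * int p) :: 'a)"
    by simp
  finally have "vge 1 c" by (simp only: xy of_int_1)
  then show False using pos by (simp add: vge_iff c_def)
qed

lemma val_of_int:
  assumes "m \<noteq> 0"
  shows "val (of_int m) = real (multiplicity (int p) m)"
proof -
  have "prime_elem (int p)" using prime_p by simp
  then have nu: "\<not> is_unit (int p)" by auto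
  obtain k where k: "m = int p ^ multiplicity (int p) m * k" "\<not> int p dvd k"
    using multiplicity_decompose'[OF assms nu] by blast
  have "coprime k (int p)"
    using k(2) prime_p by (metis coprime_commute prime_imp_coprime prime_nat_int_transfer)
  moreover have "k \<noteq> 0" using k(2) by auto
  ultimately have "val (of_int k) = 0" by (intro val_of_int_coprime)
  moreover have "of_int m = (of_nat p ^ multiplicity (int p) m * of_int k :: 'a)"
    by (subst k(1)) simp
  ultimately show ?thesis
    using \<open>k \<noteq> 0\<close> prime_p by (simp add: val_mult val_power val_p prime_gt_0_nat)
qed

lemma val_of_nat:
  assumes "n \<noteq> 0"
  shows "val (of_nat n) = real (multiplicity p n)"
  using val_of_int[of "int n"] assms
  by (simp add: multiplicity_def flip: of_nat_power)

lemma val_fact_lower_bound: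
  assumes "\<delta> > 0"
  shows "\<exists>C. \<forall>j. val (fact j) \<ge> real j / (real p - 1) - \<delta> * real j - C"
proof -
  have "val (fact j) = real (multiplicity p (fact j :: nat))" for j
    using val_of_nat[of "fact j"] by simp
  then show ?thesis using multiplicity_fact_lower_bound[OF prime_p assms] by simp
qed

lemma vge_progression_product:
  fixes c d :: int
  assumes "coprime c (int p)"
  shows "vge (of_int (\<Prod>i<j. c * int i + d)) (val (fact j))"
proof (cases "(\<Prod>i<j. c * int i + d) = 0")
  case False
  let ?x = "\<Prod>i<j. c * int i + d" and ?e = "multiplicity p (fact j :: nat)"
  have "coprime c (int (p ^ ?e))" using assms by simp
  then have "int (p ^ ?e) dvd ?x"
    by (rule dvd_progression_product) (auto simp: multiplicity_dvd prime_gt_0_nat prime_p)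
  then have "?e \<le> multiplicity (int p) ?x"
    using False prime_p by (intro multiplicity_geI) (auto simp: prime_elem_def)
  then have "val (of_int ?x) \<ge> real ?e" using val_of_int[OF False] by simp
  moreover have "val (fact j) = real ?e" using val_of_nat[of "fact j"] by simp
  ultimately show ?thesis by (simp add: vge_iff)
qed (simp only: of_int_0 vge_zero not_not)

subsection \<open>Convergent series\<close>

definition null_seq :: "(nat \<Rightarrow> 'a) \<Rightarrow> bool" where
  "null_seq f \<longleftrightarrow> (\<forall>M. \<exists>N. \<forall>n\<ge>N. vge (f n) M)"

definition vsum :: "(nat \<Rightarrow> 'a) \<Rightarrow> 'a" where
  "vsum f = (SOME s. valuation_limit ord (\<lambda>N. \<Sum>i<N. f i) s)"

lemma vge_sum_diff:
  fixes f :: "nat \<Rightarrow> 'a"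
  assumes "\<And>n. n \<ge> N \<Longrightarrow> vge (f n) M" and "m \<ge> N" and "n \<ge> N"
  shows "vge ((\<Sum>i<m. f i) - (\<Sum>i<n. f i)) M"
proof -
  have *: "vge ((\<Sum>i<m. f i) - (\<Sum>i<n. f i)) M" if "m \<ge> n" "n \<ge> N" for m n
  proof -
    have "(\<Sum>i<m. f i) - (\<Sum>i<n. f i) = (\<Sum>i=n..<m. f i)"
      using that sum_diff_nat_ivl[of 0 n m f] by (simp add: lessThan_atLeast0)
    then show ?thesis using that assms(1) by (auto intro!: vge_sum)
  qed
  show ?thesis
    using *[of n m] *[of m n] assms(2,3) vge_minus[of "(\<Sum>i<m. f i) - (\<Sum>i<n. f i)"]
    by (cases "n \<le> m") auto
qed

text \<open>In a complete ultrametric field, terms tending to zero suffice: the difference of two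
  partial sums is no larger than the largest term between them.\<close>

lemma vsum_limit:
  assumes "null_seq f"
  shows "valuation_limit ord (\<lambda>N. \<Sum>i<N. f i) (vsum f)"
proof -
  have "valuation_Cauchy ord (\<lambda>N. \<Sum>i<N. f i)"
    using assms vge_sum_diff[of _ f] unfolding valuation_Cauchy_def null_seq_def vge_def[symmetric]
    by meson
  from complete[OF this] show ?thesis unfolding vsum_def by (rule someI_ex)
qed

lemma vge_vsum_diff:
  assumes "null_seq f" and "\<And>n. n \<ge> N \<Longrightarrow> vge (f n) M"
  shows "vge (vsum f - (\<Sum>i<N. f i)) M"
proof -
  obtain N' where N': "\<And>n. n \<ge> N' \<Longrightarrow> vge ((\<Sum>i<n. f i) - vsum f) M"
    using vsum_limit[OF assms(1)] unfolding valuation_limit_def vge_def by blast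
  let ?n = "max N N'"
  have "vge (((\<Sum>i<?n. f i) - (\<Sum>i<N. f i)) - ((\<Sum>i<?n. f i) - vsum f)) M"
    by (intro vge_diff vge_sum_diff[of N] N' assms(2)) auto
  then show ?thesis by simp
qed

lemma vge_vsum:
  assumes "null_seq f" and "\<And>n. vge (f n) M"
  shows "vge (vsum f) M"
  using vge_vsum_diff[of f 0 M] assms by simp

lemma vsum_eqI:
  assumes "null_seq f" and "\<And>M. \<exists>N0. \<forall>N\<ge>N0. vge ((\<Sum>i<N. f i) - s) M"
  shows "vsum f = s"
proof -
  have "vge (vsum f - s) M" for M
  proof -
    obtain N0 where N0: "\<And>N. N \<ge> N0 \<Longrightarrow> vge ((\<Sum>i<N. f i) - s) M" using assms(2) by blast
    obtain N1 where N1: "\<And>N. N \<ge> N1 \<Longrightarrow> vge ((\<Sum>i<N. f i) - vsum f) M"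
      using vsum_limit[OF assms(1)] unfolding valuation_limit_def vge_def by blast
    let ?n = "max N0 N1"
    have "vge (((\<Sum>i<?n. f i) - s) - ((\<Sum>i<?n. f i) - vsum f)) M"
      by (intro vge_diff N0 N1) auto
    then show ?thesis by simp
  qed
  then show ?thesis using eq_zero_if_vge by (metis right_minus_eq)
qed

lemma null_seq_add: "null_seq f \<Longrightarrow> null_seq g \<Longrightarrow> null_seq (\<lambda>i. f i + g i)"
  unfolding null_seq_def by (meson le_trans nat_le_linear vge_add)

lemma null_seq_cmult:
  assumes "null_seq f"
  shows "null_seq (\<lambda>i. c * f i)"
proof (cases "c = 0")
  case False
  have "vge (c * x) M" if "vge x (M - val c)" for x M
    using vge_mult[of c "val c" x "M - val c"] that by (simp add: vge_iff[of c])
  then show ?thesis using assms unfolding null_seq_def by meson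
qed (simp add: null_seq_def)

lemma vge_partial_sums:
  assumes "null_seq f"
  obtains N where "\<And>n. n \<ge> N \<Longrightarrow> vge ((\<Sum>i<n. f i) - vsum f) M"
  using vsum_limit[OF assms] unfolding valuation_limit_def vge_def by blast

lemma vsum_add:
  assumes "null_seq f" and "null_seq g"
  shows "vsum (\<lambda>i. f i + g i) = vsum f + vsum g"
proof (rule vsum_eqI[OF null_seq_add[OF assms]])
  fix M
  obtain N1 where N1: "\<And>n. n \<ge> N1 \<Longrightarrow> vge ((\<Sum>i<n. f i) - vsum f) M"
    using vge_partial_sums[OF assms(1)] by blast
  obtain N2 where N2: "\<And>n. n \<ge> N2 \<Longrightarrow> vge ((\<Sum>i<n. g i) - vsum g) M"
    using vge_partial_sums[OF assms(2)] by blast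
  have "vge ((\<Sum>i<n. f i + g i) - (vsum f + vsum g)) M" if "n \<ge> max N1 N2" for n
    using vge_add[OF N1[of n] N2[of n]] that by (simp add: sum.distrib algebra_simps)
  then show "\<exists>N0. \<forall>n\<ge>N0. vge ((\<Sum>i<n. f i + g i) - (vsum f + vsum g)) M" by blast
qed

lemma vsum_cmult:
  assumes "null_seq f"
  shows "vsum (\<lambda>i. c * f i) = c * vsum f"
proof (rule vsum_eqI[OF null_seq_cmult[OF assms]])
  fix M
  obtain N where N: "\<And>n. n \<ge> N \<Longrightarrow> vge ((\<Sum>i<n. f i) - vsum f) (M - val c)"
    using vge_partial_sums[OF assms] by blast
  have "vge ((\<Sum>i<n. c * f i) - c * vsum f) M" if "n \<ge> N" for n
    using vge_mult[of c "val c", OF _ N[OF that]]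
    by (simp add: vge_iff[of c] sum_distrib_left[symmetric] right_diff_distrib)
  then show "\<exists>N0. \<forall>n\<ge>N0. vge ((\<Sum>i<n. c * f i) - c * vsum f) M" by blast
qed

lemma vsum_Suc:
  assumes "null_seq f"
  shows "vsum f = f 0 + vsum (\<lambda>i. f (Suc i))"
proof (rule vsum_eqI[OF assms])
  fix M
  have "null_seq (\<lambda>i. f (Suc i))"
    using assms unfolding null_seq_def by (meson le_Suc_eq)
  then obtain N where N: "\<And>n. n \<ge> N \<Longrightarrow> vge ((\<Sum>i<n. f (Suc i)) - vsum (\<lambda>i. f (Suc i))) M"
    using vge_partial_sums by blast
  have "vge ((\<Sum>i<n. f i) - (f 0 + vsum (\<lambda>i. f (Suc i)))) M" if n: "n \<ge> Suc N" for n
  proof -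
    obtain m where "n = Suc m" using n by (cases n) auto
    then show ?thesis using N[of m] n
      by (simp only: sum.lessThan_Suc_shift) (simp add: algebra_simps)
  qed
  then show "\<exists>N0. \<forall>n\<ge>N0. vge ((\<Sum>i<n. f i) - (f 0 + vsum (\<lambda>i. f (Suc i)))) M" by blast
qed

text \<open>Summing over the triangle \<open>l + m < N\<close> differs from summing the first \<open>N\<close> rows only by
  tails of rows.\<close>

lemma vsum_Cauchy_product:
  fixes f :: "nat \<Rightarrow> nat \<Rightarrow> 'a"
  assumes e: "e > 0" and f: "\<And>l m. vge (f l m) (e * real (l + m) + c)"
  shows "vsum (\<lambda>l. vsum (f l)) = vsum (\<lambda>s. \<Sum>l\<le>s. f l (s - l))"
proof -
  have big: "\<exists>N. \<forall>n\<ge>N. e * real n + c \<ge> M" for M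
  proof -
    obtain N :: nat where N: "real N \<ge> (M - c) / e" using real_arch_simple by blast
    have "e * real n + c \<ge> M" if "n \<ge> N" for n
    proof -
      have "(M - c) / e \<le> real n" using N that by linarith
      then show ?thesis using e by (simp add: field_simps)
    qed
    then show ?thesis by blast
  qed
  have ml: "e * real n + c \<le> e * real m + c" if "n \<le> m" for n m
    using that e by simp
  have row: "null_seq (f l)" for l
    unfolding null_seq_def using big f ml by (meson le_add2 vge_mono order_trans)
  have rows: "null_seq (\<lambda>l. vsum (f l))"
    unfolding null_seq_def
  proof
    fix M
    obtain N where N: "\<And>n. n \<ge> N \<Longrightarrow> e * real n + c \<ge> M" using big by blast
    have "vge (vsum (f n)) M" if "n \<ge> N" for n
      using that by (intro vge_vsum[OF row] vge_mono[OF f] N) auto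
    then show "\<exists>N. \<forall>n\<ge>N. vge (vsum (f n)) M" by blast
  qed
  have diag: "null_seq (\<lambda>s. \<Sum>l\<le>s. f l (s - l))"
    unfolding null_seq_def
  proof
    fix M
    obtain N where N: "\<And>n. n \<ge> N \<Longrightarrow> e * real n + c \<ge> M" using big by blast
    have "vge (\<Sum>l\<le>n. f l (n - l)) M" if "n \<ge> N" for n
      using that by (intro vge_sum vge_mono[OF f] N) auto
    then show "\<exists>N. \<forall>n\<ge>N. vge (\<Sum>l\<le>n. f l (n - l)) M" by blast
  qed
  show ?thesis
  proof (rule vsum_eqI[OF rows])
    fix M
    obtain N where N: "\<And>n. n \<ge> N \<Longrightarrow> e * real n + c \<ge> M" using big by blast
    obtain N' where N': "\<And>n. n \<ge> N' \<Longrightarrow>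
        vge ((\<Sum>s<n. \<Sum>l\<le>s. f l (s - l)) - vsum (\<lambda>s. \<Sum>l\<le>s. f l (s - l))) M"
      using vge_partial_sums[OF diag] by blast
    have "vge ((\<Sum>l<n. vsum (f l)) - vsum (\<lambda>s. \<Sum>l\<le>s. f l (s - l))) M"
      if n: "n \<ge> max N N'" for n
    proof -
      have tri: "(\<Sum>s<n. \<Sum>l\<le>s. f l (s - l)) = (\<Sum>l<n. \<Sum>m<n-l. f l m)"
      proof (induction n)
        case (Suc n)
        have "(\<Sum>l<Suc n. \<Sum>m<Suc n - l. f l m) = (\<Sum>l<Suc n. (\<Sum>m<n - l. f l m) + f l (n - l))"
          by (intro sum.cong) (auto simp: Suc_diff_le)
        then show ?case using Suc by (simp add: sum.distrib) (simp add: lessThan_Suc_atMost[symmetric])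
      qed simp
      have "vge (\<Sum>l<n. vsum (f l) - (\<Sum>m<n-l. f l m)) M"
        using n by (intro vge_sum vge_vsum_diff row vge_mono[OF f] N) auto
      then have "vge ((\<Sum>l<n. vsum (f l)) - (\<Sum>s<n. \<Sum>l\<le>s. f l (s - l))) M"
        by (simp add: tri sum_subtractf)
      from vge_add[OF this N'[of n]] show ?thesis using n by simp
    qed
    then show "\<exists>N0. \<forall>n\<ge>N0. vge ((\<Sum>l<n. vsum (f l)) - vsum (\<lambda>s. \<Sum>l\<le>s. f l (s - l))) M" by blast
  qed
qed

subsection \<open>Power series acting on two-sided sequences\<close>

text \<open>This is convergence on the open unit disc |z| < 1.\<close>

definition subexp :: "'a fps \<Rightarrow> bool" where
  "subexp h \<longleftrightarrow> (\<forall>d>0. \<exists>C. \<forall>l. vge (fps_nth h l) (- d * real l - C))"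

text \<open>For e > 0 this means decay towards +infinity and limited growth towards -infinity. The
  first makes \<open>act\<close> converge; the two directions are used against the forward and the
  backward recurrence.\<close>

definition bdd :: "real \<Rightarrow> (int \<Rightarrow> 'a) \<Rightarrow> bool" where
  "bdd e x \<longleftrightarrow> (\<exists>\<rho>. \<forall>n. vge (x n) (e * real_of_int n + \<rho>))"

text \<open>Multiplication of the Laurent series \<open>\<Sum>n. x(n) T\<^bsup>n\<^esup>\<close> by the power series \<open>h(z)\<close> in \<open>z = 1 / T\<^sup>3\<close>.\<close>

definition act :: "'a fps \<Rightarrow> (int \<Rightarrow> 'a) \<Rightarrow> int \<Rightarrow> 'a" where
  "act h x n = vsum (\<lambda>l. fps_nth h l * x (n + 3 * int l))"

lemma subexpE:
  assumes "subexp h" and "d > 0"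
  obtains C where "\<And>l. vge (fps_nth h l) (- d * real l - C)"
  using assms unfolding subexp_def by blast

lemma subexp_const [simp]: "subexp (fps_const c)"
  unfolding subexp_def
proof (intro allI impI)
  fix d :: real assume "d > 0"
  have "vge (fps_nth (fps_const c) l) (- d * real l - (- val c))" for l
    using \<open>d > 0\<close> by (simp add: vge_iff)
  then show "\<exists>C. \<forall>l. vge (fps_nth (fps_const c) l) (- d * real l - C)" by blast
qed

lemma subexp_0 [simp]: "subexp 0" and subexp_1 [simp]: "subexp 1"
  using subexp_const[of 0] subexp_const[of 1] by simp_all

lemma subexp_add:
  assumes "subexp f" and "subexp g"
  shows "subexp (f + g)"
  unfolding subexp_def
proof (intro allI impI)
  fix d :: real assume "d > 0"
  obtain C where C: "\<And>l. vge (fps_nth f l) (- d * real l - C)"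
    using subexpE[OF assms(1) \<open>d > 0\<close>] by blast
  obtain C' where C': "\<And>l. vge (fps_nth g l) (- d * real l - C')"
    using subexpE[OF assms(2) \<open>d > 0\<close>] by blast
  have "vge (fps_nth (f + g) l) (- d * real l - max C C')" for l
    unfolding fps_add_nth by (intro vge_add vge_mono[OF C] vge_mono[OF C']) auto
  then show "\<exists>C. \<forall>l. vge (fps_nth (f + g) l) (- d * real l - C)" by blast
qed

lemma subexp_mult:
  assumes "subexp f" and "subexp g"
  shows "subexp (f * g)"
  unfolding subexp_def
proof (intro allI impI)
  fix d :: real assume "d > 0"
  obtain C where C: "\<And>l. vge (fps_nth f l) (- d * real l - C)"
    using subexpE[OF assms(1) \<open>d > 0\<close>] by blast
  obtain C' where C': "\<And>l. vge (fps_nth g l) (- d * real l - C')"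
    using subexpE[OF assms(2) \<open>d > 0\<close>] by blast
  have "vge (fps_nth (f * g) n) (- d * real n - (C + C'))" for n
    unfolding fps_mult_nth
  proof (rule vge_sum)
    fix i assume "i \<in> {0..n}"
    then have "(- d * real i - C) + (- d * real (n - i) - C') = - d * real n - (C + C')"
      by (simp add: algebra_simps of_nat_diff)
    then show "vge (fps_nth f i * fps_nth g (n - i)) (- d * real n - (C + C'))"
      using vge_mult[OF C[of i] C'[of "n - i"]] by (simp only:)
  qed
  then show "\<exists>C. \<forall>l. vge (fps_nth (f * g) l) (- d * real l - C)" by blast
qed

lemma subexp_minus: "subexp f \<Longrightarrow> subexp (- f)"
  by (simp add: subexp_def)

lemma subexp_X [simp]: "subexp fps_X"
  unfolding subexp_def
proof (intro allI impI)
  fix d :: real assume "d > 0"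
  then have "vge (fps_nth fps_X l) (- d * real l - 0)" for l
    by (auto simp: vge_iff fps_X_def)
  then show "\<exists>C. \<forall>l. vge (fps_nth fps_X l) (- d * real l - C)" by blast
qed

lemma subexp_sum: "(\<And>i. i \<in> A \<Longrightarrow> subexp (f i)) \<Longrightarrow> subexp (sum f A)"
  by (induction A rule: infinite_finite_induct) (auto simp: subexp_add)

lemma subexp_X_deriv:
  assumes "subexp f"
  shows "subexp (fps_X * fps_deriv f)"
  unfolding subexp_def
proof (intro allI impI)
  fix d :: real assume "d > 0"
  obtain C where C: "\<And>l. vge (fps_nth f l) (- d * real l - C)"
    using subexpE[OF assms \<open>d > 0\<close>] by blast
  have "vge (fps_nth (fps_X * fps_deriv f) l) (- d * real l - C)" for l
    using vge_mult[OF vge_of_nat[of l] C[of l]] by (cases l) auto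
  then show "\<exists>C. \<forall>l. vge (fps_nth (fps_X * fps_deriv f) l) (- d * real l - C)" by blast
qed

lemma bddE:
  assumes "bdd e x"
  obtains \<rho> where "\<And>n. vge (x n) (e * real_of_int n + \<rho>)"
  using assms unfolding bdd_def by blast

lemma bdd_shift:
  assumes "bdd e x"
  shows "bdd e (\<lambda>n. x (n - c))"
proof -
  obtain \<rho> where \<rho>: "\<And>n. vge (x n) (e * real_of_int n + \<rho>)" using bddE[OF assms] by blast
  have "vge (x (n - c)) (e * real_of_int n + (\<rho> - e * real_of_int c))" for n
    using \<rho>[of "n - c"] by (simp add: algebra_simps)
  then show ?thesis unfolding bdd_def by blast
qed

lemma bdd_add:
  assumes "bdd e x" and "bdd e y"
  shows "bdd e (\<lambda>n. x n + y n)"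
proof -
  obtain \<rho> where \<rho>: "\<And>n. vge (x n) (e * real_of_int n + \<rho>)" using bddE[OF assms(1)] by blast
  obtain \<sigma> where \<sigma>: "\<And>n. vge (y n) (e * real_of_int n + \<sigma>)" using bddE[OF assms(2)] by blast
  have "vge (x n + y n) (e * real_of_int n + min \<rho> \<sigma>)" for n
    by (intro vge_add vge_mono[OF \<rho>] vge_mono[OF \<sigma>]) auto
  then show ?thesis unfolding bdd_def by blast
qed

lemma bdd_zero: "bdd e (\<lambda>n. 0)"
  by (simp add: bdd_def)

lemma bdd_sum: "(\<And>i. i \<in> A \<Longrightarrow> bdd e (x i)) \<Longrightarrow> bdd e (\<lambda>n. \<Sum>i\<in>A. x i n)"
  by (induction A rule: infinite_finite_induct) (auto simp: bdd_add bdd_zero)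

lemma bdd_cmult:
  assumes "bdd e x"
  shows "bdd e (\<lambda>n. c * x n)"
proof -
  obtain \<rho> where \<rho>: "\<And>n. vge (x n) (e * real_of_int n + \<rho>)" using bddE[OF assms] by blast
  have "vge (c * x n) (e * real_of_int n + (val c + \<rho>))" for n
    using vge_mult[OF _ \<rho>[of n], of c "val c"] by (simp add: vge_iff[of c] add_ac)
  then show ?thesis unfolding bdd_def by blast
qed

lemma bdd_of_int_mult:
  assumes "bdd e x"
  shows "bdd e (\<lambda>n. of_int n * x n)"
proof -
  obtain \<rho> where \<rho>: "\<And>n. vge (x n) (e * real_of_int n + \<rho>)" using bddE[OF assms] by blast
  have "vge (of_int n * x n) (e * real_of_int n + \<rho>)" for n
    using vge_mult[OF vge_of_int[of n] \<rho>[of n]] by simp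
  then show ?thesis unfolding bdd_def by blast
qed

lemma null_seq_linear:
  assumes "e > 0" and "\<And>l. vge (f l) (e * real l + c)"
  shows "null_seq f"
  unfolding null_seq_def
proof
  fix M
  obtain N :: nat where N: "real N \<ge> (M - c) / e" using real_arch_simple by blast
  have "vge (f n) M" if "n \<ge> N" for n
  proof (rule vge_mono[OF assms(2)])
    have "(M - c) / e \<le> real n" using N that by linarith
    then show "M \<le> e * real n + c" using assms(1) by (simp add: field_simps)
  qed
  then show "\<exists>N. \<forall>n\<ge>N. vge (f n) M" by blast
qed

context
  fixes e :: real
  assumes e: "e > 0"
begin

text \<open>The shift by 3 l gains 3 e l. Subexponential growth, taken at rate e, costs only e l, so
  a positive slope in l remains.\<close>

lemma act_term_bound:
  assumes "subexp h" and "bdd e x"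
  obtains c where "\<And>n l. vge (fps_nth h l * x (n + 3 * int l)) (e * real l + (e * real_of_int n + c))"
proof -
  obtain \<rho> where \<rho>: "\<And>n. vge (x n) (e * real_of_int n + \<rho>)" using bddE[OF assms(2)] by blast
  obtain C where C: "\<And>l. vge (fps_nth h l) (- e * real l - C)"
    using subexpE[OF assms(1) e] by blast
  have "vge (fps_nth h l * x (n + 3 * int l)) (e * real l + (e * real_of_int n + (\<rho> - C)))" for n l
    using e by (intro vge_mono[OF vge_mult[OF C \<rho>]]) (simp add: algebra_simps)
  then show ?thesis using that by blast
qed

lemma act_null:
  assumes "subexp h" and "bdd e x"
  shows "null_seq (\<lambda>l. fps_nth h l * x (n + 3 * int l))"
proof -
  obtain c where "\<And>n l. vge (fps_nth h l * x (n + 3 * int l)) (e * real l + (e * real_of_int n + c))"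
    using act_term_bound[OF assms] by blast
  then show ?thesis by (rule null_seq_linear[OF e])
qed

lemma bdd_act:
  assumes "subexp h" and "bdd e x"
  shows "bdd e (act h x)"
proof -
  obtain c where c: "\<And>n l. vge (fps_nth h l * x (n + 3 * int l)) (e * real l + (e * real_of_int n + c))"
    using act_term_bound[OF assms] by blast
  have "vge (act h x n) (e * real_of_int n + c)" for n
    unfolding act_def using e by (intro vge_vsum act_null assms vge_mono[OF c]) auto
  then show ?thesis unfolding bdd_def by blast
qed

lemma act_add_left:
  assumes "subexp h" and "subexp h'" and "bdd e x"
  shows "act (h + h') x n = act h x n + act h' x n"
  unfolding act_def by (subst vsum_add[symmetric]) (auto intro!: act_null assms simp: ring_distribs mult.left_commute)

lemma act_add_right:
  assumes "subexp h" and "bdd e x" and "bdd e y"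
  shows "act h (\<lambda>n. x n + y n) n = act h x n + act h y n"
  unfolding act_def by (subst vsum_add[symmetric]) (auto intro!: act_null assms simp: ring_distribs mult.left_commute)

lemma act_0_left [simp]: "act 0 x n = 0"
  using vsum_eqI[of "\<lambda>_. 0" 0] by (simp add: act_def null_seq_def)

lemma act_0_right [simp]: "act h (\<lambda>n. 0) n = 0"
  using vsum_eqI[of "\<lambda>_. 0" 0] by (simp add: act_def null_seq_def)

lemma act_sum_left:
  assumes "\<And>i. i \<in> A \<Longrightarrow> subexp (h i)" and "bdd e x"
  shows "act (\<Sum>i\<in>A. h i) x n = (\<Sum>i\<in>A. act (h i) x n)"
  using assms(1)
  by (induction A rule: infinite_finite_induct) (simp_all add: act_add_left subexp_sum assms(2))

lemma act_sum_right:
  assumes "subexp h" and "\<And>i. i \<in> A \<Longrightarrow> bdd e (x i)"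
  shows "act h (\<lambda>n. \<Sum>i\<in>A. x i n) n = (\<Sum>i\<in>A. act h (x i) n)"
  using assms(2)
  by (induction A rule: infinite_finite_induct) (simp_all add: act_add_right bdd_sum assms(1))

lemma act_cmult_right:
  assumes "subexp h" and "bdd e x"
  shows "act h (\<lambda>n. c * x n) n = c * act h x n"
  unfolding act_def
  by (subst vsum_cmult[symmetric]) (auto intro!: act_null assms simp: ring_distribs mult.left_commute)

text \<open>Together with additivity this makes the bounded sequences a module over the
  subexponential series. The double series is rearranged as a Cauchy product.\<close>

lemma act_mult:
  assumes h: "subexp h" and h': "subexp h'" and x: "bdd e x"
  shows "act h (act h' x) n = act (h * h') x n"
proof -
  obtain \<rho> where \<rho>: "\<And>n. vge (x n) (e * real_of_int n + \<rho>)" using bddE[OF x] by blast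
  obtain C where C: "\<And>l. vge (fps_nth h l) (- e * real l - C)"
    using subexpE[OF h e] by blast
  obtain C' where C': "\<And>l. vge (fps_nth h' l) (- e * real l - C')"
    using subexpE[OF h' e] by blast
  define f where "f l m = fps_nth h l * (fps_nth h' m * x (n + 3 * int l + 3 * int m))" for l m
  have f: "vge (f l m) (e * real (l + m) + (e * real_of_int n + \<rho> - C - C'))" for l m
    unfolding f_def using e
    by (intro vge_mono[OF vge_mult[OF C vge_mult[OF C' \<rho>]]]) (simp add: algebra_simps)
  have "act h (act h' x) n = vsum (\<lambda>l. vsum (f l))"
    unfolding act_def f_def using act_null[OF h' x] by (subst vsum_cmult) auto
  also have "\<dots> = vsum (\<lambda>s. \<Sum>l\<le>s. f l (s - l))"
    by (rule vsum_Cauchy_product[OF e f])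
  also have "(\<lambda>s. \<Sum>l\<le>s. f l (s - l)) = (\<lambda>s. fps_nth (h * h') s * x (n + 3 * int s))"
  proof
    fix s
    have "f l (s - l) = fps_nth h l * fps_nth h' (s - l) * x (n + 3 * int s)" if "l \<le> s" for l
    proof -
      have "n + 3 * int l + 3 * int (s - l) = n + 3 * int s" using that by simp
      then show ?thesis by (simp only: f_def mult.assoc)
    qed
    then show "(\<Sum>l\<le>s. f l (s - l)) = fps_nth (h * h') s * x (n + 3 * int s)"
      by (simp add: fps_mult_nth sum_distrib_right atMost_atLeast0)
  qed
  finally show ?thesis by (simp add: act_def)
qed

lemma act_const:
  assumes "bdd e x"
  shows "act (fps_const c) x n = c * x n"
proof -
  have "act (fps_const c) x n = vsum (\<lambda>l. fps_nth (fps_const c) l * x (n + 3 * int l))"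
    by (simp add: act_def)
  also have "\<dots> = c * x n + vsum (\<lambda>l. 0)"
    by (subst vsum_Suc) (use act_null[OF subexp_const assms] in auto)
  finally show ?thesis using vsum_eqI[of "\<lambda>_. 0" 0] by (simp add: null_seq_def)
qed

lemma act_X:
  assumes "subexp h" and "bdd e x"
  shows "act (fps_X * h) x n = act h x (n + 3)"
proof -
  have "act (fps_X * h) x n = vsum (\<lambda>l. fps_nth (fps_X * h) l * x (n + 3 * int l))"
    by (simp add: act_def)
  also have "\<dots> = 0 + vsum (\<lambda>l. fps_nth h l * x (n + 3 * int (Suc l)))"
    by (subst vsum_Suc) (use act_null[OF subexp_mult[OF subexp_X assms(1)] assms(2)] in auto)
  finally show ?thesis by (simp add: act_def algebra_simps)
qed

lemma act_const_mult:
  assumes "subexp h" and "bdd e x"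
  shows "act (fps_const c * h) x n = c * act h x n"
  using act_mult[OF subexp_const assms, of c n] act_const[OF bdd_act[OF assms], of c n] by simp

text \<open>Multiplication by n is T d/dT on Laurent series, and z = 1 / T^3 turns it into -3 z d/dz
  on h. The identity is the Leibniz rule.\<close>

lemma act_deriv:
  assumes "subexp h" and "bdd e x"
  shows "of_int n * act h x n =
    act (fps_const (- 3) * (fps_X * fps_deriv h)) x n + act h (\<lambda>n. of_int n * x n) n"
proof -
  have "act (fps_const (- 3) * (fps_X * fps_deriv h)) x n + act h (\<lambda>n. of_int n * x n) n
    = vsum (\<lambda>l. fps_nth (fps_const (- 3) * (fps_X * fps_deriv h)) l * x (n + 3 * int l)
        + fps_nth h l * (of_int (n + 3 * int l) * x (n + 3 * int l)))"
    unfolding act_def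
    by (rule vsum_add[symmetric]; rule act_null)
      (intro subexp_mult subexp_const subexp_X_deriv assms bdd_of_int_mult)+
  also have "\<dots> = vsum (\<lambda>l. of_int n * (fps_nth h l * x (n + 3 * int l)))"
    by (rule arg_cong[where f = vsum]) (auto simp: fun_eq_iff algebra_simps)
  also have "\<dots> = of_int n * act h x n"
    unfolding act_def by (rule vsum_cmult[OF act_null[OF assms]])
  finally show ?thesis by simp
qed

end

subsection \<open>Exponential recurrences on an annulus\<close>

text \<open>Upwards, g behaves like the coefficients of an exponential. The i factors \<kappa> have
  total valuation i / (p - 1), and the progression in the denominator has at least that of i!, which
  is nearly the same. So the valuation of g(n + 3 i) exceeds a constant by at most e i, against the
  required 3 e i.\<close>

lemma exp_recurrence_forward:
  fixes k m :: int
  assumes p: "p \<ge> 5" and e: "e > 0" and g: "bdd e g"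
    and \<kappa>: "\<kappa> \<noteq> 0" "val \<kappa> = 1 / (real p - 1)" and m: "m \<noteq> 0" "val (of_int m) = 0"
    and rec: "\<And>n. of_int (2 * n - k) * g n = \<kappa> * of_int m * g (n - 3)"
  shows "g n = 0"
proof (rule ccontr)
  assume gn: "g n \<noteq> 0"
  \<comment> \<open>The factor for l = 0 belongs to the index n + 3.\<close>
  define Q where "Q i = (\<Prod>l<i. 6 * int l + (2 * n + 6 - k))" for i
  have iter: "g (n + 3 * int i) * of_int (Q i) = (\<kappa> * of_int m) ^ i * g n" for i
  proof (induction i)
    case (Suc i)
    have "g (n + 3 * int (Suc i)) * of_int (Q (Suc i)) =
        (of_int (2 * (n + 3 * int (Suc i)) - k) * g (n + 3 * int (Suc i))) * of_int (Q i)"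
      by (simp add: Q_def algebra_simps)
    also have "\<dots> = \<kappa> * of_int m * (g (n + 3 * int i) * of_int (Q i))"
      by (subst rec) (simp add: algebra_simps)
    finally show ?case by (simp add: Suc)
  qed (simp add: Q_def)
  obtain \<rho> where \<rho>: "\<And>n. vge (g n) (e * real_of_int n + \<rho>)" using bddE[OF g] by blast
  obtain C where C: "\<And>j. val (fact j) \<ge> real j / (real p - 1) - e * real j - C"
    using val_fact_lower_bound[OF e] by blast
  have six: "coprime 6 (int p)"
    using coprime_6_prime[OF prime_p p] by simp
  have bound: "2 * e * real i \<le> val (g n) + C - \<rho> - e * real_of_int n" for i
  proof -
    have "(\<kappa> * of_int m) ^ i * g n \<noteq> 0" using gn \<kappa> m by simp
    \<comment> \<open>\<open>iter\<close> is free of division; that no factor vanishes follows from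
      g n \<noteq> 0.\<close>
    then have nz: "g (n + 3 * int i) \<noteq> 0" "of_int (Q i) \<noteq> (0::'a)"
      using iter[of i] by auto
    have "val (g (n + 3 * int i)) + val (of_int (Q i)) = val ((\<kappa> * of_int m) ^ i * g n)"
      using nz by (simp flip: iter add: val_mult)
    also have "\<dots> = real i / (real p - 1) + val (g n)"
      using gn \<kappa> m by (simp add: val_mult val_power)
    finally have "val (g (n + 3 * int i)) + val (of_int (Q i)) = real i / (real p - 1) + val (g n)" .
    moreover have "val (of_int (Q i)) \<ge> val (fact i)"
      using vge_progression_product[OF six, where j = i and d = "2 * n + 6 - k"] nz
      unfolding Q_def[symmetric] vge_iff by blast
    moreover have "val (g (n + 3 * int i)) \<ge> e * (real_of_int n + 3 * real i) + \<rho>"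
      using \<rho>[of "n + 3 * int i"] nz by (simp add: vge_iff)
    ultimately show ?thesis using C[of i] by (simp add: algebra_simps)
  qed
  obtain i :: nat where "real i > (val (g n) + C - \<rho> - e * real_of_int n) / (2 * e)"
    using reals_Archimedean2 by blast
  with bound[of i] e show False by (simp add: field_simps)
qed

text \<open>Downwards the progression multiplies. Its valuation is at most about i / (p - 1) + i /
  4, while dividing by (\<kappa> m)^i takes away at least i / (p - 1) + i. The valuation thus drops
  by 3 i / 4, but e \<le> 1 / 12 allows only i / 4, up to constants. Oddness of k keeps every factor
  nonzero.\<close>

lemma exp_recurrence_backward:
  fixes k m :: int
  assumes p: "p \<ge> 5" and e: "e \<le> 1 / 12" and g: "bdd e g"
    and \<kappa>: "\<kappa> \<noteq> 0" "val \<kappa> = 1 / (real p - 1)" and m: "m \<noteq> 0" "val (of_int m) \<ge> 1"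
    and rec: "\<And>n. of_int (2 * n - k) * g n = \<kappa> * of_int m * g (n - 3)"
    and "odd k"
  shows "g n = 0"
proof (rule ccontr)
  assume gn: "g n \<noteq> 0"
  define Q where "Q i = (\<Prod>l<i. (2 * n - k) - 6 * int l)" for i
  have iter: "of_int (Q i) * g n = (\<kappa> * of_int m) ^ i * g (n - 3 * int i)" for i
  proof (induction i)
    case (Suc i)
    have "of_int (Q (Suc i)) * g n = of_int (2 * (n - 3 * int i) - k) * (of_int (Q i) * g n)"
      by (simp add: Q_def algebra_simps)
    also have "\<dots> = (\<kappa> * of_int m) ^ i * (of_int (2 * (n - 3 * int i) - k) * g (n - 3 * int i))"
      unfolding Suc by (simp only: mult_ac)
    also have "\<dots> = (\<kappa> * of_int m) ^ i * (\<kappa> * of_int m * g (n - 3 * int (Suc i)))"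
      by (subst rec) (simp add: algebra_simps)
    finally show ?case by (simp add: mult_ac)
  qed (simp add: Q_def)
  obtain \<rho> where \<rho>: "\<And>n. vge (g n) (e * real_of_int n + \<rho>)" using bddE[OF g] by blast
  have odd: "2 * n - k - 6 * int l \<noteq> 0" for l
    using \<open>odd k\<close> by presburger
  define B where "B = \<bar>real_of_int (2 * n - k)\<bar> + 3 + val (g n) - e * real_of_int n - \<rho>"
  have bound: "real i / 2 \<le> B" for i
  proof -
    have Q: "Q i \<noteq> 0" using odd by (simp add: Q_def)
    then have "(\<kappa> * of_int m) ^ i * g (n - 3 * int i) \<noteq> 0"
      using gn by (simp flip: iter)
    then have nz: "g (n - 3 * int i) \<noteq> 0" by auto
    have "val (of_int (Q i)) = (\<Sum>l<i. real (multiplicity (int p) (2 * n - k - 6 * int l)))"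
      unfolding Q_def of_int_prod using odd
      by (subst val_prod) (simp_all only: val_of_int of_int_eq_0_iff not_False_eq_True)
    also have "\<dots> \<le> real i / (real p - 1) + real i / 4 + \<bar>real_of_int (2 * n - k)\<bar> + 3"
      using odd by (intro multiplicity_progression_upper_bound prime_p p)
    finally have 1: "val (of_int (Q i)) \<le> \<dots>" .
    have "val (of_int (Q i)) + val (g n) = val ((\<kappa> * of_int m) ^ i * g (n - 3 * int i))"
      using gn Q by (simp flip: iter add: val_mult)
    also have "\<dots> = real i / (real p - 1) + real i * val (of_int m) + val (g (n - 3 * int i))"
      using nz \<kappa> m by (simp add: val_mult val_power algebra_simps)
    finally have 2: "val (of_int (Q i)) + val (g n) = \<dots>" .
    have 3: "val (g (n - 3 * int i)) \<ge> e * (real_of_int n - 3 * real i) + \<rho>"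
      using \<rho>[of "n - 3 * int i"] nz by (simp add: vge_iff)
    have 4: "real i * val (of_int m) \<ge> real i" using m by (simp add: mult_le_cancel_left1)
    have "e * real i \<le> 1 / 12 * real i" using e by (intro mult_right_mono) auto
    with 1 2 3 4 show ?thesis unfolding B_def by (simp add: algebra_simps)
  qed
  obtain i :: nat where "real i > 2 * B" using reals_Archimedean2 by blast
  with bound[of i] show False by simp
qed

end

subsection \<open>Binary forms\<close>

text \<open>The truncated exponents n - 1 and m - 1 are harmless because their terms carry the
  factor n or m.\<close>

lemma derivation_binary_form:
  fixes \<Delta> :: "'b::comm_ring_1 \<Rightarrow> 'b"
  assumes Leibniz: "\<And>x y. \<Delta> (x * y) = \<Delta> x * y + x * \<Delta> y"
    and U: "\<Delta> U = a * U + b * V" and V: "\<Delta> V = c * V + d * U"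
  shows "\<Delta> (U ^ n * V ^ m) = (of_nat n * a + of_nat m * c) * (U ^ n * V ^ m)
    + of_nat n * b * (U ^ (n - 1) * V ^ (m + 1)) + of_nat m * d * (U ^ (n + 1) * V ^ (m - 1))"
proof -
  have one: "\<Delta> 1 = 0" using Leibniz[of 1 1] by simp
  have power: "\<Delta> (x ^ i) = of_nat i * (x ^ (i - 1) * \<Delta> x)" for x i
  proof (induction i)
    case (Suc i)
    have "x * (of_nat i * (x ^ (i - 1) * \<Delta> x)) = of_nat i * (x ^ i * \<Delta> x)"
      by (cases i) (auto simp: algebra_simps)
    then show ?case by (simp add: Leibniz Suc algebra_simps)
  qed (simp add: one)
  have pred: "of_nat i * x ^ (i - 1) * x = of_nat i * x ^ i" for x :: 'b and i
    by (cases i) (auto simp: algebra_simps)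
  have "\<Delta> (U ^ n * V ^ m) =
      (of_nat n * U ^ (n - 1) * U) * a * V ^ m + of_nat n * b * (U ^ (n - 1) * V ^ (m + 1))
      + U ^ n * (of_nat m * V ^ (m - 1) * V) * c + of_nat m * d * (U ^ (n + 1) * V ^ (m - 1))"
    by (simp add: Leibniz power U V algebra_simps)
  then show ?thesis unfolding pred by (simp add: algebra_simps)
qed

text \<open>F is a dehomogenised binary form. Its degree n is given separately, since the polynomial
  F may have smaller degree.\<close>

definition homogenize :: "nat \<Rightarrow> 'b::comm_ring_1 poly \<Rightarrow> 'b poly \<Rightarrow> 'b poly \<Rightarrow> 'b poly" where
  "homogenize n F U V = (\<Sum>j\<le>n. Polynomial.smult (coeff F j) (U ^ (n - j) * V ^ j))"

lemma homogenize_linear_mult: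
  assumes "degree F \<le> n"
  shows "homogenize (Suc n) ([:A, B:] * F) U V = (Polynomial.smult A U + Polynomial.smult B V) * homogenize n F U V"
proof -
  have F: "coeff F (Suc n) = 0" using assms by (simp add: coeff_eq_0)
  have "homogenize (Suc n) ([:A, B:] * F) U V =
      (\<Sum>j\<le>Suc n. Polynomial.smult (A * coeff F j) (U ^ (Suc n - j) * V ^ j)) +
      (\<Sum>j\<le>Suc n. Polynomial.smult (coeff (pCons 0 (Polynomial.smult B F)) j) (U ^ (Suc n - j) * V ^ j))"
    by (simp only: homogenize_def mult_pCons_left mult_zero_left add_0_right coeff_add coeff_smult
        smult_add_left sum.distrib pCons_0_0)
  also have "(\<Sum>j\<le>Suc n. Polynomial.smult (coeff (pCons 0 (Polynomial.smult B F)) j) (U ^ (Suc n - j) * V ^ j)) =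
      (\<Sum>j\<le>n. Polynomial.smult (B * coeff F j) (U ^ (n - j) * V ^ Suc j))"
    by (subst sum.atMost_Suc_shift) simp
  also have "\<dots> = Polynomial.smult B V * homogenize n F U V"
    by (simp add: homogenize_def sum_distrib_left mult_ac)
  also have "(\<Sum>j\<le>Suc n. Polynomial.smult (A * coeff F j) (U ^ (Suc n - j) * V ^ j)) =
      (\<Sum>j\<le>n. Polynomial.smult A U * Polynomial.smult (coeff F j) (U ^ (n - j) * V ^ j))"
    by (simp add: F Suc_diff_le mult_ac)
  also have "\<dots> = Polynomial.smult A U * homogenize n F U V"
    by (simp add: homogenize_def sum_distrib_left)
  finally show ?thesis by (simp add: algebra_simps)
qed

lemma degree_linear_powers:
  fixes A B C D :: "'b::comm_ring_1"
  shows "degree ([:A, B:] ^ a * [:C, D:] ^ b) \<le> a + b"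
proof -
  have "degree ([:A, B:] ^ a) \<le> a" for A B :: 'b and a
    using degree_power_le[of "[:A, B:]" a] by (rule order_trans) (simp add: degree_pCons_eq_if)
  then show ?thesis by (intro order_trans[OF degree_mult_le] add_mono)
qed

lemma homogenize_linear_powers:
  "homogenize (a + b) ([:A, B:] ^ a * [:C, D:] ^ b) U V =
    (Polynomial.smult A U + Polynomial.smult B V) ^ a * (Polynomial.smult C U + Polynomial.smult D V) ^ b"
proof (induction a)
  case 0
  show ?case
  proof (induction b)
    case (Suc b)
    have "homogenize (Suc b) ([:C, D:] * [:C, D:] ^ b) U V =
        (Polynomial.smult C U + Polynomial.smult D V) * homogenize b ([:C, D:] ^ b) U V"
      using degree_linear_powers[of 0 0 0 C D b] by (intro homogenize_linear_mult) simp
    then show ?case using Suc by simp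
  qed (simp add: homogenize_def)
next
  case (Suc a)
  have "homogenize (Suc (a + b)) ([:A, B:] * ([:A, B:] ^ a * [:C, D:] ^ b)) U V =
      (Polynomial.smult A U + Polynomial.smult B V) * homogenize (a + b) ([:A, B:] ^ a * [:C, D:] ^ b) U V"
    by (intro homogenize_linear_mult degree_linear_powers)
  then show ?case using Suc by (simp only: power_Suc add_Suc mult.assoc)
qed

lemma coeff_linear_powers_top:
  fixes A B C D :: "'b::comm_ring_1"
  shows "coeff ([:A, B:] ^ a * [:C, D:] ^ b) (a + b) = B ^ a * D ^ b"
proof (induction a)
  case 0
  show ?case
  proof (induction b)
    case (Suc b)
    have "degree ([:C, D:] ^ b) \<le> b" using degree_linear_powers[of 0 0 0 C D b] by simp
    then have "coeff ([:C, D:] ^ b) (Suc b) = 0" by (simp add: coeff_eq_0)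
    then show ?case using Suc by simp
  qed simp
next
  case (Suc a)
  have "coeff ([:A, B:] ^ a * [:C, D:] ^ b) (Suc (a + b)) = 0"
    using degree_linear_powers[of A B a C D b] by (simp add: coeff_eq_0)
  then have "coeff ([:A, B:] * ([:A, B:] ^ a * [:C, D:] ^ b)) (Suc (a + b)) = B ^ Suc a * D ^ b"
    using Suc by simp
  then show ?case by (simp only: power_Suc add_Suc mult.assoc)
qed

subsection \<open>The Euler operator on power series\<close>

definition theta :: "'b::comm_ring_1 fps \<Rightarrow> 'b fps" where "theta f = fps_X * fps_deriv f"

lemma fps_nth_theta [simp]: "fps_nth (theta f) n = of_nat n * fps_nth f n"
  by (cases n) (auto simp: theta_def)

lemma theta_add [simp]: "theta (f + g) = theta f + theta g"
  by (simp add: theta_def algebra_simps)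

lemma theta_diff [simp]: "theta (f - g) = theta f - theta g"
  by (simp add: theta_def algebra_simps)

lemma theta_mult: "theta (f * g) = theta f * g + f * theta g"
  by (simp add: theta_def algebra_simps)

lemma theta_const [simp]: "theta (fps_const c) = 0" and theta_X [simp]: "theta fps_X = fps_X"
  by (simp_all add: theta_def)

lemma theta_numeral [simp]: "theta (numeral n) = 0" by (simp add: numeral_fps_const)

lemma theta_0 [simp]: "theta 0 = 0" by (simp add: theta_def)

lemma theta_sum: "theta (sum f A) = (\<Sum>i\<in>A. theta (f i))"
  by (induction A rule: infinite_finite_induct) auto

subsection \<open>Airy series at infinity\<close>

text \<open>With \<open>a = T\<^sup>2\<close> and \<open>z = 1 / T\<^sup>3\<close>, the system \<open>X' = - \<pi> Y\<close>, \<open>Y' = (\<pi> a / 3) X\<close> has the formal solutions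
  \<open>X = T powr (-1/2) * exp (\<mu> T\<^sup>3) * \<phi>(z)\<close>, \<open>Y = T powr (1/2) * exp (\<mu> T\<^sup>3) * \<psi>(z)\<close>
  for both roots of \<open>27 \<mu>\<^sup>2 = - 4 \<pi>\<^sup>2\<close>. Here \<open>\<phi>\<close> is the usual asymptotic series of the Airy function.\<close>

definition airy_phi :: "'b::field_char_0 \<Rightarrow> 'b fps" where
  "airy_phi \<mu> = Abs_fps (\<lambda>j. \<Prod>i<j. of_int ((6 * int i + 5) * (6 * int i + 1)) / (72 * \<mu> * of_nat (Suc i)))"

text \<open>Solved from X' = - \<pi> Y after stripping the exponential and the powers of T. The 2
  comes from d/da = (1 / (2 T)) d/dT.\<close>

definition airy_psi :: "'b::field_char_0 \<Rightarrow> 'b \<Rightarrow> 'b fps" where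
  "airy_psi \<pi> \<mu> = fps_const (- 1 / (2 * \<pi>)) *
    (fps_const (3 * \<mu>) * airy_phi \<mu> - fps_X * (fps_const (1 / 2) * airy_phi \<mu> + 3 * theta (airy_phi \<mu>)))"

lemma airy_phi_nth_0 [simp]: "fps_nth (airy_phi \<mu>) 0 = 1"
  by (simp add: airy_phi_def)

lemma airy_psi_nth_0 [simp]: "fps_nth (airy_psi \<pi> \<mu>) 0 = - (3 * \<mu>) / (2 * \<pi>)"
  by (simp add: airy_psi_def)

text \<open>The Airy equation for \<phi>. In coefficients it is the ratio of consecutive ones, as (6
  j + 5)(6 j + 1) / 4 = 9 j^2 + 9 j + 5 / 4.\<close>

lemma airy_phi_theta:
  fixes \<mu> :: "'a::field_char_0"
  assumes "\<mu> \<noteq> 0"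
  shows "fps_const (18 * \<mu>) * theta (airy_phi \<mu>) = fps_X *
    (9 * theta (theta (airy_phi \<mu>)) + 9 * theta (airy_phi \<mu>) + fps_const (5 / 4) * airy_phi \<mu>)"
    (is "?L = ?R")
proof (rule fps_ext)
  fix n
  show "fps_nth ?L n = fps_nth ?R n"
  proof (cases n)
    case (Suc j)
    define u where "u = fps_nth (airy_phi \<mu>) j"
    have "fps_nth (airy_phi \<mu>) (Suc j) =
        u * (of_int ((6 * int j + 5) * (6 * int j + 1)) / (72 * \<mu> * of_nat (Suc j)))"
      by (simp add: airy_phi_def u_def)
    also have "of_int ((6 * int j + 5) * (6 * int j + 1)) = (6 * of_nat j + 5) * (6 * of_nat j + (1::'a))"
      by simp
    finally have u: "18 * \<mu> * of_nat (Suc j) * fps_nth (airy_phi \<mu>) (Suc j) =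
        u * ((6 * of_nat j + 5) * (6 * of_nat j + 1)) / 4"
      using assms by (simp del: of_nat_Suc add: field_simps)
    have "fps_nth ?L n = 18 * \<mu> * of_nat (Suc j) * fps_nth (airy_phi \<mu>) (Suc j)"
      by (simp add: Suc mult_ac)
    also have "\<dots> = 9 * (of_nat j * (of_nat j * u)) + 9 * (of_nat j * u) + 5 / 4 * u"
      unfolding u by (simp add: field_simps)
    also have "\<dots> = fps_nth ?R n"
      by (simp add: Suc u_def numeral_fps_const)
    finally show ?thesis .
  qed simp
qed

lemma airy_phi_ode:
  fixes \<pi> \<mu> :: "'a::field_char_0"
  assumes "\<pi> \<noteq> 0"
  shows "fps_X * (fps_const (- 3) * theta (airy_phi \<mu>)) =
    (fps_const (1 / 2) * fps_X - fps_const (3 * \<mu>)) * airy_phi \<mu> - fps_const (2 * \<pi>) * airy_psi \<pi> \<mu>"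
proof -
  have "fps_const (2 * \<pi>) * airy_psi \<pi> \<mu> =
    fps_const (2 * \<pi>) * fps_const (- 1 / (2 * \<pi>)) *
    (fps_const (3 * \<mu>) * airy_phi \<mu> - fps_X * (fps_const (1 / 2) * airy_phi \<mu> + 3 * theta (airy_phi \<mu>)))"
    by (simp only: airy_psi_def mult.assoc)
  also have "fps_const (2 * \<pi>) * fps_const (- 1 / (2 * \<pi>)) = - 1"
    using assms by (simp add: fps_const_mult flip: fps_const_neg)
  finally have psi: "fps_const (2 * \<pi>) * airy_psi \<pi> \<mu> = - 1 * (fps_const (3 * \<mu>) * airy_phi \<mu> -
      fps_X * (fps_const (1 / 2) * airy_phi \<mu> + 3 * theta (airy_phi \<mu>)))" .
  have "fps_const (- 3) = (- 3 :: 'a fps)" by (simp add: numeral_fps_const)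
  then show ?thesis unfolding psi by (simp only:) (simp only: ring_distribs, simp)
qed

text \<open>This is Y' = (\<pi> a / 3) X. While \<open>airy_phi_ode\<close> restates the definition
  of \<psi>, this equation rests on the Airy equation and the choice of \<mu>.\<close>

lemma airy_psi_ode:
  fixes \<pi> \<mu> :: "'a::field_char_0"
  assumes "\<pi> \<noteq> 0" and "\<mu> \<noteq> 0" and \<mu>: "27 * \<mu>\<^sup>2 = - 4 * \<pi>\<^sup>2"
  shows "fps_X * (fps_const (- 3) * theta (airy_psi \<pi> \<mu>)) =
    (- fps_const (1 / 2) * fps_X - fps_const (3 * \<mu>)) * airy_psi \<pi> \<mu> + fps_const (2 * \<pi> / 3) * airy_phi \<mu>"
proof -
  define h where "h = fps_const (1 / 2 :: 'a)"
  define M where "M = fps_const \<mu>"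
  define c where "c = fps_const (- 1 / (2 * \<pi>))"
  define f where "f = airy_phi \<mu>"
  define \<chi> where "\<chi> = 3 * M * f - fps_X * (h * f + 3 * theta f)"
  have cst: "fps_const (3 * \<mu>) = 3 * M" "fps_const (18 * \<mu>) = 18 * M" "fps_const (- 3) = (- 3 :: 'a fps)"
      "fps_const (5 / 4) = 5 * h\<^sup>2"
    by (simp_all add: M_def h_def numeral_fps_const fps_const_mult power2_eq_square)
  have h: "2 * h = 1" by (simp add: h_def numeral_fps_const fps_const_mult)
  have "c * (- 9 * M\<^sup>2) = fps_const (- 1 / (2 * \<pi>) * (- 9 * \<mu>\<^sup>2))"
    by (simp add: c_def M_def numeral_fps_const fps_const_mult power2_eq_square)
  also have "- 1 / (2 * \<pi>) * (- 9 * \<mu>\<^sup>2) = - (2 * \<pi> / 3)"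
    using assms(1) \<mu> by (simp add: field_simps power2_eq_square)
  finally have c: "fps_const (2 * \<pi> / 3) = c * (9 * M\<^sup>2)" by (simp flip: fps_const_neg)
  have psi: "airy_psi \<pi> \<mu> = c * \<chi>"
    by (simp only: airy_psi_def c_def \<chi>_def cst f_def h_def)
  have ode: "18 * M * theta f = fps_X * (9 * theta (theta f) + 9 * theta f + 5 * h\<^sup>2 * f)"
    using airy_phi_theta[OF assms(2)] by (simp only: cst f_def)
  have num: "theta (3 * g) = 3 * theta g" for g :: "'a fps"
    by (simp add: numeral_fps_const theta_mult)
  have "theta M = 0" "theta h = 0" by (simp_all add: M_def h_def)
  then have "theta \<chi> = 3 * M * theta f - fps_X * (h * f + 3 * theta f) - fps_X * (h * theta f + 3 * theta (theta f))"
    by (simp add: \<chi>_def theta_mult num mult.assoc)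
  \<comment> \<open>A polynomial identity whose last two summands vanish by \<open>ode\<close> and
    by 2 h = 1.\<close>
  then have "fps_X * (- 3 * theta \<chi>) + h * fps_X * \<chi> + 3 * M * \<chi> = 9 * M\<^sup>2 * f
    + fps_X * (fps_X * (9 * theta (theta f) + 9 * theta f + 5 * h\<^sup>2 * f) - 18 * M * theta f)
    + 3 * h * (1 - 2 * h) * fps_X\<^sup>2 * f"
    unfolding \<chi>_def by (simp only:) (simp add: algebra_simps power2_eq_square)
  then have "fps_X * (- 3 * theta \<chi>) + h * fps_X * \<chi> + 3 * M * \<chi> = 9 * M\<^sup>2 * f"
    by (simp only: ode h) simp
  then have "c * (fps_X * (- 3 * theta \<chi>) + h * fps_X * \<chi> + 3 * M * \<chi>) = c * (9 * M\<^sup>2) * f"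
    by (simp only: mult.assoc)
  moreover have "theta (c * \<chi>) = c * theta \<chi>" by (simp add: c_def theta_mult)
  ultimately show ?thesis
    unfolding psi c cst f_def[symmetric] h_def[symmetric] by (simp add: algebra_simps)
qed

subsection \<open>The diagonalising frame\<close>

locale airy_frame = padic_complex_field p ord
  for p :: nat and ord :: "'a::field_char_0 \<Rightarrow> ereal" +
  fixes \<pi> \<mu> :: 'a
  assumes p5: "p \<ge> 5" and pi_power: "\<pi> ^ (p - 1) = - of_nat p" and mu_square: "27 * \<mu>\<^sup>2 = - 4 * \<pi>\<^sup>2"
begin

section \<open>Valuations of the constants and growth of the Airy series\<close>

lemma pi_nonzero: "\<pi> \<noteq> 0"
  using pi_power p5 by (cases "p - 1") auto

lemma mu_nonzero: "\<mu> \<noteq> 0"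
  using mu_square pi_nonzero by auto

lemma val_pi: "val \<pi> = 1 / (real p - 1)"
proof -
  have "real (p - 1) * val \<pi> = val (\<pi> ^ (p - 1))" by (simp add: val_power pi_nonzero)
  also have "\<dots> = 1" by (simp only: pi_power val_minus val_p)
  finally show ?thesis using p5 by (simp add: field_simps of_nat_diff)
qed

lemma val_4: "val 4 = 0" and val_27: "val 27 = 0" and val_72: "val 72 = 0"
proof -
  have "coprime 6 (int p)" using prime_p p5 by (rule coprime_6_prime)
  then have "coprime (2 * 3) (int p)" by simp
  then have "coprime 2 (int p)" "coprime 3 (int p)" unfolding coprime_mult_left_iff by blast+
  then have 23: "val 2 = 0" "val 3 = 0"
    using val_of_int_coprime[of 2] val_of_int_coprime[of 3] by simp_all
  show "val 4 = 0" "val 27 = 0" using val_power[of 2 2] val_power[of 3 3] 23 by simp_all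
  show "val 72 = 0" using val_mult[of 8 9] val_power[of 2 3] val_power[of 3 2] 23 by simp
qed

lemma val_mu: "val \<mu> = 1 / (real p - 1)"
proof -
  have "2 * val \<mu> = val (27 * \<mu>\<^sup>2)"
    using mu_nonzero by (simp add: val_mult val_power val_27)
  also have "\<dots> = val (4 * \<pi>\<^sup>2)" unfolding mu_square by simp
  also have "\<dots> = 2 * val \<pi>"
    using pi_nonzero by (simp add: val_mult val_power val_4)
  finally show ?thesis by (simp add: val_pi)
qed

text \<open>Each of the two progressions in the numerator has at least the valuation of j!, and the
  denominator (72 m)^j j! costs j / (p - 1) plus that of j!. The remaining val (j!) - j / (p - 1) is
  at least -d j - C. General m covers both \<mu> and -\<mu>.\<close>

lemma subexp_airy_phi:
  assumes "m \<noteq> 0" and "val m = 1 / (real p - 1)"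
  shows "subexp (airy_phi m)"
  unfolding subexp_def
proof (intro allI impI)
  fix d :: real assume "d > 0"
  obtain C where C: "\<And>j. val (fact j) \<ge> real j / (real p - 1) - d * real j - C"
    using val_fact_lower_bound[OF \<open>d > 0\<close>] by blast
  have six: "coprime 6 (int p)" using prime_p p5 by (rule coprime_6_prime)
  have "vge (fps_nth (airy_phi m) j) (- d * real j - C)" for j
  proof -
    define A where "A = (of_int (\<Prod>i<j. 6 * int i + 5) :: 'a)"
    define B where "B = (of_int (\<Prod>i<j. 6 * int i + 1) :: 'a)"
    define E where "E = (72 * m) ^ j * (fact j :: 'a)"
    have "E = (\<Prod>i<j. 72 * m * of_nat (Suc i))"
      unfolding E_def by (simp add: prod.distrib fact_prod_Suc lessThan_atLeast0 del: of_nat_Suc)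
    then have "fps_nth (airy_phi m) j = (\<Prod>i<j. of_int ((6 * int i + 5) * (6 * int i + 1))) / E"
      by (simp only: airy_phi_def fps_nth_Abs_fps prod_dividef)
    then have nth: "fps_nth (airy_phi m) j = A * B * inverse E"
      by (simp only: A_def B_def prod.distrib divide_inverse of_int_mult of_int_prod)
    have E: "E \<noteq> 0" using assms by (simp add: E_def)
    have "val (72 * m) = val m"
      using assms by (simp add: val_mult val_72)
    then have "val E = real j * val m + val (fact j)"
      using assms by (simp add: E_def val_mult val_power)
    then have "val (inverse E) = - (real j / (real p - 1) + val (fact j))"
      using E by (simp add: val_inverse assms)
    then have "vge (inverse E) (- (real j / (real p - 1) + val (fact j)))" by (simp add: vge_iff)
    moreover have "vge A (val (fact j))" "vge B (val (fact j))"
      unfolding A_def B_def by (rule vge_progression_product[OF six])+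
    ultimately have "vge (A * B * inverse E)
        (val (fact j) + val (fact j) + - (real j / (real p - 1) + val (fact j)))"
      by (intro vge_mult)
    then show ?thesis unfolding nth by (rule vge_mono) (use C[of j] in simp)
  qed
  then show "\<exists>C. \<forall>l. vge (fps_nth (airy_phi m) l) (- d * real l - C)" by blast
qed

lemma subexp_airy_psi:
  assumes "m \<noteq> 0" and "val m = 1 / (real p - 1)"
  shows "subexp (airy_psi \<pi> m)"
proof -
  have "airy_psi \<pi> m = fps_const (- 1 / (2 * \<pi>)) * (fps_const (3 * m) * airy_phi m +
      - (fps_X * (fps_const (1 / 2) * airy_phi m + fps_const 3 * (fps_X * fps_deriv (airy_phi m)))))"
    by (simp add: airy_psi_def theta_def numeral_fps_const)
  then show ?thesis
    by (simp only:) (intro subexp_mult subexp_add subexp_minus subexp_const subexp_X subexp_X_deriv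
        subexp_airy_phi assms)
qed

abbreviation "\<phi> \<equiv> airy_phi \<mu>"
abbreviation "\<phi>' \<equiv> airy_phi (- \<mu>)"
abbreviation "\<psi> \<equiv> airy_psi \<pi> \<mu>"
abbreviation "\<psi>' \<equiv> airy_psi \<pi> (- \<mu>)"

lemma subexp_frame: "subexp \<phi>" "subexp \<phi>'" "subexp \<psi>" "subexp \<psi>'"
  using mu_nonzero val_mu by (auto intro!: subexp_airy_phi subexp_airy_psi)

lemma ode:
  fixes M H :: "'a fps"
  defines "M \<equiv> fps_const (3 * \<mu>)" and "H \<equiv> fps_const (1 / 2) * fps_X"
  shows "fps_X * (fps_const (- 3) * theta \<phi>) = (H - M) * \<phi> - fps_const (2 * \<pi>) * \<psi>"
    and "fps_X * (fps_const (- 3) * theta \<phi>') = (H + M) * \<phi>' - fps_const (2 * \<pi>) * \<psi>'"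
    and "fps_X * (fps_const (- 3) * theta \<psi>) = (- H - M) * \<psi> + fps_const (2 * \<pi> / 3) * \<phi>"
    and "fps_X * (fps_const (- 3) * theta \<psi>') = (- H + M) * \<psi>' + fps_const (2 * \<pi> / 3) * \<phi>'"
proof -
  have neg: "fps_const (3 * - \<mu>) = - M" by (simp add: M_def)
  have half: "- fps_const (1 / 2) * fps_X = - H" by (simp only: H_def mult_minus_left)
  show "fps_X * (fps_const (- 3) * theta \<phi>) = (H - M) * \<phi> - fps_const (2 * \<pi>) * \<psi>"
    using airy_phi_ode[OF pi_nonzero, of \<mu>] by (simp only: M_def H_def)
  show "fps_X * (fps_const (- 3) * theta \<phi>') = (H + M) * \<phi>' - fps_const (2 * \<pi>) * \<psi>'"
    using airy_phi_ode[OF pi_nonzero, of "- \<mu>"] unfolding neg by (simp only: H_def diff_minus_eq_add)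
  show "fps_X * (fps_const (- 3) * theta \<psi>) = (- H - M) * \<psi> + fps_const (2 * \<pi> / 3) * \<phi>"
    using airy_psi_ode[OF pi_nonzero mu_nonzero mu_square] unfolding half by (simp only: M_def)
  have "- \<mu> \<noteq> 0" "27 * (- \<mu>)\<^sup>2 = - 4 * \<pi>\<^sup>2" using mu_nonzero mu_square by simp_all
  from airy_psi_ode[OF pi_nonzero this]
  show "fps_X * (fps_const (- 3) * theta \<psi>') = (- H + M) * \<psi>' + fps_const (2 * \<pi> / 3) * \<phi>'"
    unfolding half neg by (simp only: diff_minus_eq_add)
qed

section \<open>The frame of the two Airy solutions and its differential equation\<close>

definition wronskian :: "'a fps" where "wronskian = \<phi> * \<psi>' - \<phi>' * \<psi>"

text \<open>The system has trace zero and the two exponentials cancel, so the Wronskian is constant;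
  its value is read off at z = 0.\<close>

lemma wronskian_eq: "wronskian = fps_const (3 * \<mu> / \<pi>)"
proof -
  let ?t = "\<lambda>f. fps_X * (fps_const (- 3) * theta f)"
  have "?t wronskian = ?t \<phi> * \<psi>' + \<phi> * ?t \<psi>' - (?t \<phi>' * \<psi> + \<phi>' * ?t \<psi>)"
    by (simp add: wronskian_def theta_mult algebra_simps)
  also have "\<dots> = 0"
  proof -
    have "((H - M) * f - P * g) * g' + f * ((- H + M) * g' + R * f')
        - (((H + M) * f' - P * g') * g + f' * ((- H - M) * g + R * f)) = 0" for H M P R f f' g g' :: "'a fps"
      by (simp add: algebra_simps)
    then show ?thesis unfolding ode .
  qed
  finally have "theta wronskian = 0" by simp
  then have "of_nat n * fps_nth wronskian n = 0" for n
    by (metis fps_nth_theta fps_zero_nth)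
  then have "fps_nth wronskian n = 0" if "n > 0" for n
    using that by (metis less_irrefl mult_eq_0_iff of_nat_eq_0_iff)
  moreover have "fps_nth wronskian 0 = 3 * \<mu> / \<pi>"
    using pi_nonzero by (simp add: wronskian_def field_simps)
  ultimately show ?thesis by (intro fps_ext) auto
qed

text \<open>The factors \<open>exp (\<plusminus>\<mu> T\<^sup>3)\<close> and the fractional powers of \<open>T\<close> are stripped off. The indeterminate
  of these polynomials over power series separates the two Airy solutions.\<close>

definition U :: "'a fps poly" where "U = [:\<phi>, \<phi>':]"
definition V :: "'a fps poly" where "V = [:\<psi>, \<psi>':]"
text \<open>\<open>U'\<close> and \<open>V'\<close> encode the adjugate of the frame: \<phi> U' +
  \<phi>' V' is the Wronskian, and \<psi> U' + \<psi>' V' is the Wronskian times the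
  indeterminate.\<close>

definition U' :: "'a fps poly" where "U' = [:\<psi>', - \<phi>':]"
definition V' :: "'a fps poly" where "V' = [:- \<psi>, \<phi>:]"

text \<open>Coefficient \<open>j\<close> is multiplied by \<open>exp ((k - 2 j) \<mu> T\<^sup>3)\<close> up to a common power of \<open>T\<close>; the second
  term of the operator accounts for the derivative of these exponentials.\<close>

definition Delta :: "'a fps poly \<Rightarrow> 'a fps poly" where
  "Delta F = Polynomial.smult (fps_X * fps_const (- 3)) (map_poly theta F)
    - Polynomial.smult (fps_const (6 * \<mu>)) (pCons 0 (pderiv F))"

lemma coeff_Delta: "coeff (Delta F) j =
    fps_X * (fps_const (- 3) * theta (coeff F j)) - fps_const (6 * \<mu> * of_nat j) * coeff F j"
proof -
  have "fps_const (6 * \<mu> * of_nat j) = fps_const (6 * \<mu>) * of_nat j"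
    by (simp add: fps_of_nat[symmetric])
  then show ?thesis
    by (cases j) (simp_all add: Delta_def coeff_map_poly coeff_pderiv mult.assoc)
qed

lemma Delta_mult: "Delta (F * G) = Delta F * G + F * Delta G"
proof -
  have "map_poly theta (F * G) = map_poly theta F * G + F * map_poly theta G"
    by (rule poly_eqI) (simp add: coeff_map_poly coeff_mult theta_sum theta_mult sum.distrib)
  moreover have "pCons 0 (pderiv (F * G)) = pCons 0 (pderiv F) * G + F * pCons 0 (pderiv G)"
    by (simp add: pderiv_mult algebra_simps)
  ultimately show ?thesis
    by (simp add: Delta_def smult_add_right algebra_simps)
qed

text \<open>In coefficient 1 the exponential term of \<open>Delta\<close> turns 3 \<mu> into -3
  \<mu>, so both Airy solutions satisfy one and the same equation.\<close>

lemma Delta_U: "Delta U =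
    [:fps_const (1 / 2) * fps_X - fps_const (3 * \<mu>):] * U + [:- fps_const (2 * \<pi>):] * V"
proof (rule poly_eqI)
  fix j :: nat
  have 6: "fps_const (6 * \<mu>) = fps_const (3 * \<mu>) + fps_const (3 * \<mu>)" by simp
  have id: "((H + M) * f - P * g) - (M + M) * f = (H - M) * f + (- P) * g" for H M P f g :: "'a fps"
    by (simp add: algebra_simps)
  consider "j = 0" | "j = 1" | "j \<ge> 2" by linarith
  then show "coeff (Delta U) j = coeff ([:fps_const (1 / 2) * fps_X - fps_const (3 * \<mu>):] * U + [:- fps_const (2 * \<pi>):] * V) j"
  proof cases
    case 1
    then show ?thesis unfolding coeff_Delta by (simp add: U_def V_def ode(1) del: fps_const_neg)
  next
    case 2
    have "coeff (Delta U) 1 = fps_X * (fps_const (- 3) * theta \<phi>') - fps_const (6 * \<mu>) * \<phi>'"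
      unfolding coeff_Delta by (simp add: U_def)
    also have "\<dots> = (fps_const (1 / 2) * fps_X - fps_const (3 * \<mu>)) * \<phi>' + (- fps_const (2 * \<pi>)) * \<psi>'"
      unfolding ode 6 by (rule id)
    finally show ?thesis unfolding 2 by (simp add: U_def V_def del: fps_const_neg)
  next
    case 3
    then show ?thesis unfolding coeff_Delta by (simp add: U_def V_def coeff_eq_0)
  qed
qed

lemma Delta_V: "Delta V =
    [:- fps_const (1 / 2) * fps_X - fps_const (3 * \<mu>):] * V + [:fps_const (2 * \<pi> / 3):] * U"
proof (rule poly_eqI)
  fix j :: nat
  have 6: "fps_const (6 * \<mu>) = fps_const (3 * \<mu>) + fps_const (3 * \<mu>)" by simp
  have half: "- (fps_const (1 / 2) * fps_X) = - fps_const (1 / 2 :: 'a) * fps_X"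
    by (simp only: mult_minus_left)
  have id: "((- H + M) * f + P * g) - (M + M) * f = (- H - M) * f + P * g" for H M P f g :: "'a fps"
    by (simp add: algebra_simps)
  consider "j = 0" | "j = 1" | "j \<ge> 2" by linarith
  then show "coeff (Delta V) j = coeff ([:- fps_const (1 / 2) * fps_X - fps_const (3 * \<mu>):] * V + [:fps_const (2 * \<pi> / 3):] * U) j"
  proof cases
    case 1
    then show ?thesis unfolding coeff_Delta by (simp add: U_def V_def ode(3) del: fps_const_neg)
  next
    case 2
    have "coeff (Delta V) 1 = fps_X * (fps_const (- 3) * theta \<psi>') - fps_const (6 * \<mu>) * \<psi>'"
      unfolding coeff_Delta by (simp add: V_def)
    also have "\<dots> = (- fps_const (1 / 2) * fps_X - fps_const (3 * \<mu>)) * \<psi>' + fps_const (2 * \<pi> / 3) * \<phi>'"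
      unfolding ode 6 half[symmetric] by (rule id)
    finally show ?thesis unfolding 2 by (simp add: U_def V_def del: fps_const_neg)
  next
    case 3
    then show ?thesis unfolding coeff_Delta by (simp add: U_def V_def coeff_eq_0)
  qed
qed

section \<open>Symmetric power of the frame\<close>

definition form_coeff :: "nat \<Rightarrow> nat \<Rightarrow> nat \<Rightarrow> 'a fps" where
  "form_coeff k c j = coeff (U ^ (k - c) * V ^ c) j"

text \<open>The derivation rule for U^(k-c) V^c, read in coefficient j. The weights T powr (-1/2) of
  X and T powr (1/2) of Y produce (k - 2 c) / 2; the exponential attached to coefficient j produces
  k - 2 j.\<close>

lemma form_coeff_ode:
  assumes "c \<le> k"
  shows "fps_X * (fps_const (- 3) * theta (form_coeff k c j)) =
    fps_const ((of_nat k - 2 * of_nat c) / 2) * (fps_X * form_coeff k c j)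
    - fps_const (3 * \<mu> * (of_nat k - 2 * of_nat j)) * form_coeff k c j
    - fps_const (2 * \<pi> * of_nat (k - c)) * form_coeff k (c + 1) j
    + fps_const (2 * \<pi> / 3 * of_nat c) * form_coeff k (c - 1) j"
proof -
  define F where "F = form_coeff k c j"
  have up: "of_nat (k - c) * [:x:] * (U ^ (k - c - 1) * V ^ (c + 1)) =
      of_nat (k - c) * ([:x:] * (U ^ (k - (c + 1)) * V ^ (c + 1)))" for x
    by (simp add: mult.assoc)
  \<comment> \<open>For c = 0 the exponents differ, but the factor c vanishes.\<close>
  have down: "of_nat c * [:x:] * (U ^ (k - c + 1) * V ^ (c - 1)) =
      of_nat c * ([:x:] * (U ^ (k - (c - 1)) * V ^ (c - 1)))" for x
  proof (cases c)
    case (Suc d)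
    then have "k - c + 1 = k - (c - 1)" using assms by simp
    then show ?thesis by (simp add: mult.assoc)
  qed simp
  have nat: "of_nat n = [:of_nat n :: 'a fps:]" for n by (simp add: of_nat_poly)
  have "Delta (U ^ (k - c) * V ^ c) =
      (of_nat (k - c) * [:fps_const (1 / 2) * fps_X - fps_const (3 * \<mu>):]
        + of_nat c * [:- fps_const (1 / 2) * fps_X - fps_const (3 * \<mu>):]) * (U ^ (k - c) * V ^ c)
      + of_nat (k - c) * ([:- fps_const (2 * \<pi>):] * (U ^ (k - (c + 1)) * V ^ (c + 1)))
      + of_nat c * ([:fps_const (2 * \<pi> / 3):] * (U ^ (k - (c - 1)) * V ^ (c - 1)))"
    unfolding derivation_binary_form[where \<Delta> = Delta, OF Delta_mult Delta_U Delta_V] up down ..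
  then have "coeff (Delta (U ^ (k - c) * V ^ c)) j =
      (of_nat (k - c) * (fps_const (1 / 2) * fps_X - fps_const (3 * \<mu>))
        + of_nat c * (- fps_const (1 / 2) * fps_X - fps_const (3 * \<mu>))) * F
      + of_nat (k - c) * (- fps_const (2 * \<pi>) * form_coeff k (c + 1) j)
      + of_nat c * (fps_const (2 * \<pi> / 3) * form_coeff k (c - 1) j)"
    by (simp add: nat form_coeff_def F_def del: fps_const_neg)
  moreover have "of_nat (k - c) = of_nat k - (of_nat c :: 'a fps)" using assms by (simp add: of_nat_diff)
  ultimately have main: "fps_X * (fps_const (- 3) * theta F) =
      fps_const (6 * \<mu> * of_nat j) * F +
      ((of_nat k - of_nat c) * (fps_const (1 / 2) * fps_X - fps_const (3 * \<mu>))
        + of_nat c * (- fps_const (1 / 2) * fps_X - fps_const (3 * \<mu>))) * F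
      + of_nat (k - c) * (- fps_const (2 * \<pi>) * form_coeff k (c + 1) j)
      + of_nat c * (fps_const (2 * \<pi> / 3) * form_coeff k (c - 1) j)"
    by (simp only: coeff_Delta F_def[symmetric] form_coeff_def[symmetric] diff_eq_eq add_ac)
  have "of_nat n = fps_const (of_nat n :: 'a)" for n by (simp add: fps_of_nat)
  then have cst: "fps_const (6 * \<mu> * of_nat j) * F = (fps_const (3 * \<mu>) * (2 * of_nat j)) * F"
      "fps_const ((of_nat k - 2 * of_nat c) / 2) = (of_nat k - 2 * of_nat c) * fps_const (1 / 2 :: 'a)"
      "fps_const (3 * \<mu> * (of_nat k - 2 * of_nat j)) = fps_const (3 * \<mu>) * (of_nat k - 2 * of_nat j)"
      "fps_const (2 * \<pi> * of_nat (k - c)) = of_nat (k - c) * fps_const (2 * \<pi>)"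
      "fps_const (2 * \<pi> / 3 * of_nat c) = of_nat c * fps_const (2 * \<pi> / 3)"
    by (simp_all add: numeral_fps_const mult_ac)
  have id: "(M * (2 * J)) * F + ((K - C) * (h * X - M) + C * (- h * X - M)) * F + d * (- P * G) + C * (R * G')
      = ((K - 2 * C) * h) * (X * F) - (M * (K - 2 * J)) * F - (d * P) * G + (C * R) * G'"
    for M J K C h X d P G R G' :: "'a fps"
    by (simp add: algebra_simps)
  show ?thesis
    unfolding F_def[symmetric] cst(2-) by (rule trans[OF main[unfolded cst(1)] id])
qed

text \<open>Later \<eta> is \<open>stretch\<close> of the coordinates of \<xi>. Its factor T^c
  absorbs the relative weight of X and Y, so both neighbours enter with the same shift by 3.\<close>

context
  fixes k :: nat and \<eta> :: "nat \<Rightarrow> int \<Rightarrow> 'a" and e :: real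
  assumes e: "e > 0" "e \<le> 1 / 12" and bdd_eta: "\<And>c. bdd e (\<eta> c)"
    and eta_ode: "\<And>c n. c \<le> k \<Longrightarrow> of_int n * \<eta> c n = of_nat c * \<eta> c n
      + (if c = 0 then 0 else 2 * \<pi> * of_nat (k - (c - 1)) * \<eta> (c - 1) (n - 3))
      - (if c = k then 0 else 2 * \<pi> / 3 * of_nat (c + 1) * \<eta> (c + 1) (n - 3))"
    and eta_support: "\<And>c n. n < int c \<Longrightarrow> \<eta> c n = 0"
begin

text \<open>The coefficient of exp((k - 2 j) \<mu> T^3) in the form evaluated on a general Airy
  solution, up to T powr (- k / 2).\<close>

definition flat :: "nat \<Rightarrow> int \<Rightarrow> 'a" where
  "flat j n = (\<Sum>c\<le>k. act (form_coeff k c j) (\<eta> c) n)"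

lemma subexp_poly_mult:
  assumes "\<And>i. subexp (coeff F i)" and "\<And>i. subexp (coeff G i)"
  shows "subexp (coeff (F * G) i)"
  unfolding coeff_mult by (intro subexp_sum subexp_mult assms)

lemma subexp_linear_powers:
  assumes "subexp A" "subexp B" "subexp C" "subexp D"
  shows "subexp (coeff ([:A, B:] ^ m * [:C, D:] ^ n) i)"
proof -
  have pow: "subexp (coeff (F ^ m) i)" if "\<And>i. subexp (coeff F i)" for F m i
    using that by (induction m arbitrary: i) (auto intro!: subexp_poly_mult simp: coeff_pCons split: nat.split)
  have linear: "subexp (coeff [:A, B:] i)" if "subexp A" "subexp B" for A B i
    using that by (auto simp: coeff_pCons split: nat.split)
  then show ?thesis by (intro subexp_poly_mult pow linear assms)
qed

lemma subexp_form_coeff: "subexp (form_coeff k c j)"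
  unfolding form_coeff_def U_def V_def by (intro subexp_linear_powers subexp_frame)

lemma bdd_flat: "bdd e (flat j)"
  unfolding flat_def[abs_def] by (intro bdd_sum bdd_act e subexp_form_coeff bdd_eta)

text \<open>The dual connection of the form coefficients cancels that of \<open>\<eta>\<close>, so only the exponential
  factor and the half-integral power of \<open>T\<close> survive.\<close>

lemma flat_recurrence:
  "of_int (2 * n - int k) * flat j n = (- 6 * \<mu>) * of_int (int k - 2 * int j) * flat j (n - 3)"
proof -
  define N where "N = n - 3"
  define A where "A c d m = act (form_coeff k c j) (\<eta> d) m" for c d m
  have n: "n = N + 3" by (simp add: N_def)
  note sub = subexp_form_coeff
  \<comment> \<open>The equation of \<open>form_coeff\<close> carries a factor z, so it is read at N
    = n - 3.\<close>
  have one: "act (fps_const (- 3) * theta (form_coeff k c j)) (\<eta> c) n =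
      (of_nat k - 2 * of_nat c) / 2 * A c c n - 3 * \<mu> * (of_nat k - 2 * of_nat j) * A c c N
      - 2 * \<pi> * of_nat (k - c) * A (c + 1) c N + 2 * \<pi> / 3 * of_nat c * A (c - 1) c N" if "c \<le> k" for c
  proof -
    have "act (fps_const (- 3) * theta (form_coeff k c j)) (\<eta> c) n =
        act (fps_X * (fps_const (- 3) * theta (form_coeff k c j))) (\<eta> c) N"
      unfolding n by (rule act_X[OF e(1), symmetric])
        (auto intro!: subexp_mult subexp_X_deriv sub bdd_eta simp: theta_def)
    also have "\<dots> = act (fps_const ((of_nat k - 2 * of_nat c) / 2) * (fps_X * form_coeff k c j)
        + fps_const (- (3 * \<mu> * (of_nat k - 2 * of_nat j))) * form_coeff k c j
        + fps_const (- (2 * \<pi> * of_nat (k - c))) * form_coeff k (c + 1) j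
        + fps_const (2 * \<pi> / 3 * of_nat c) * form_coeff k (c - 1) j) (\<eta> c) N"
      unfolding form_coeff_ode[OF that] by (simp flip: fps_const_neg)
    also have "\<dots> = (of_nat k - 2 * of_nat c) / 2 * A c c n + - (3 * \<mu> * (of_nat k - 2 * of_nat j)) * A c c N
        + - (2 * \<pi> * of_nat (k - c)) * A (c + 1) c N + 2 * \<pi> / 3 * of_nat c * A (c - 1) c N"
      unfolding n A_def
      by (simp only: act_add_left[OF e(1)] act_const_mult[OF e(1)] act_X[OF e(1)] subexp_add subexp_mult
          subexp_const subexp_X sub bdd_eta)
    finally show ?thesis by simp
  qed
  have two: "act (form_coeff k c j) (\<lambda>n. of_int n * \<eta> c n) n = of_nat c * A c c n
      + (if c = 0 then 0 else 2 * \<pi> * of_nat (k - (c - 1))) * A c (c - 1) N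
      + (if c = k then 0 else - (2 * \<pi> / 3 * of_nat (c + 1))) * A c (c + 1) N" if "c \<le> k" for c
  proof -
    let ?a = "if c = 0 then 0 else 2 * \<pi> * of_nat (k - (c - 1))"
    let ?b = "if c = k then 0 else - (2 * \<pi> / 3 * of_nat (c + 1))"
    have "(\<lambda>n. of_int n * \<eta> c n) = (\<lambda>n. of_nat c * \<eta> c n + ?a * \<eta> (c - 1) (n - 3) + ?b * \<eta> (c + 1) (n - 3))"
      by (rule ext, subst eta_ode[OF that]) simp
    then have "act (form_coeff k c j) (\<lambda>n. of_int n * \<eta> c n) n =
        of_nat c * act (form_coeff k c j) (\<eta> c) n + ?a * act (form_coeff k c j) (\<lambda>n. \<eta> (c - 1) (n - 3)) n
        + ?b * act (form_coeff k c j) (\<lambda>n. \<eta> (c + 1) (n - 3)) n"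
      by (simp only: act_add_right[OF e(1)] act_cmult_right[OF e(1)] sub bdd_eta bdd_add bdd_cmult bdd_shift)
    moreover have "act h (\<lambda>n. x (n - 3)) n = act h x N" for h x
      by (simp add: act_def N_def algebra_simps)
    ultimately show ?thesis by (simp only: A_def)
  qed
  have "of_int n * flat j n = (\<Sum>c\<le>k. of_int n * A c c n)"
    by (simp add: flat_def A_def sum_distrib_left)
  also have "\<dots> = (\<Sum>c\<le>k. act (fps_const (- 3) * theta (form_coeff k c j)) (\<eta> c) n
      + act (form_coeff k c j) (\<lambda>n. of_int n * \<eta> c n) n)"
    unfolding A_def by (intro sum.cong refl) (simp only: act_deriv[OF e(1) sub bdd_eta] theta_def)
  \<comment> \<open>The frame gives (k - 2 c) / 2 and \<eta> gives c, together k / 2. The other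
    terms are grouped into pairs that cancel after shifting c by one.\<close>
  also have "\<dots> = (\<Sum>c\<le>k. (of_nat k / 2 * A c c n - 3 * \<mu> * (of_nat k - 2 * of_nat j) * A c c N)
      + ((if c = 0 then 0 else 2 * \<pi> * of_nat (k - (c - 1)) * A c (c - 1) N)
          - 2 * \<pi> * of_nat (k - c) * A (c + 1) c N)
      + (2 * \<pi> / 3 * of_nat c * A (c - 1) c N
          - (if c = k then 0 else 2 * \<pi> / 3 * of_nat (c + 1) * A c (c + 1) N)))"
    by (intro sum.cong refl, subst one, simp, subst two, simp) (simp add: field_simps)
  also have "\<dots> = (\<Sum>c\<le>k. of_nat k / 2 * A c c n - 3 * \<mu> * (of_nat k - 2 * of_nat j) * A c c N)"
  proof -
    have low: "(\<Sum>c\<le>k. if c = 0 then 0 else f c) = (\<Sum>c<k. f (Suc c))" for f :: "nat \<Rightarrow> 'a"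
      unfolding lessThan_Suc_atMost[symmetric] by (subst sum.lessThan_Suc_shift) simp
    have top: "(\<Sum>c\<le>k. if c = k then 0 else f c) = (\<Sum>c<k. f c)" for f :: "nat \<Rightarrow> 'a"
      unfolding lessThan_Suc_atMost[symmetric] by (simp cong: sum.cong_simp)
    have "(\<Sum>c\<le>k. 2 * \<pi> * of_nat (k - c) * A (c + 1) c N) =
        (\<Sum>c\<le>k. if c = k then 0 else 2 * \<pi> * of_nat (k - c) * A (c + 1) c N)"
      by (intro sum.cong) auto
    moreover have "(\<Sum>c\<le>k. 2 * \<pi> / 3 * of_nat c * A (c - 1) c N) =
        (\<Sum>c\<le>k. if c = 0 then 0 else 2 * \<pi> / 3 * of_nat c * A (c - 1) c N)"
      by (intro sum.cong) auto
    ultimately show ?thesis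
      unfolding sum.distrib sum_subtractf low top by simp
  qed
  also have "\<dots> = of_nat k / 2 * flat j n - 3 * \<mu> * (of_nat k - 2 * of_nat j) * flat j N"
    by (simp add: flat_def A_def sum_subtractf sum_distrib_left)
  finally show ?thesis
    by (simp add: N_def field_simps)
qed

text \<open>The two recurrence lemmas cover the cases where p does not or does divide k - 2 j. For k
  = 2 l with l < p divisibility is impossible: p would divide the nonzero l - j, whose absolute
  value is at most l.\<close>

lemma flat_zero:
  assumes "odd k \<or> k < 2 * p" and "2 * j \<noteq> k" and "j \<le> k"
  shows "flat j n = 0"
proof -
  have \<kappa>: "- 6 * \<mu> \<noteq> 0" "val (- 6 * \<mu>) = 1 / (real p - 1)"
  proof -
    have "val (of_int 6) = 0"
      using prime_p p5 by (intro val_of_int_coprime coprime_6_prime) auto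
    then show "- 6 * \<mu> \<noteq> 0" "val (- 6 * \<mu>) = 1 / (real p - 1)"
      using mu_nonzero by (simp_all add: val_mult val_mu)
  qed
  define m where "m = int k - 2 * int j"
  have m: "m \<noteq> 0" using assms(2) by (auto simp: m_def)
  note rec = flat_recurrence[where j = j, folded m_def]
  show ?thesis
  proof (cases "val (of_int m) = 0")
    case True
    show ?thesis by (rule exp_recurrence_forward[OF p5 e(1) bdd_flat \<kappa> m True rec])
  next
    case False
    then have "multiplicity (int p) m \<noteq> 0" using val_of_int[OF m] by simp
    then have dvd: "int p dvd m" by (metis not_dvd_imp_multiplicity_0)
    have "odd k"
    proof (rule ccontr)
      assume "\<not> odd k"
      then obtain l where k: "k = 2 * l" by auto
      have "m = 2 * (int l - int j)" by (simp add: m_def k)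
      moreover have "coprime (int p) 2"
        using coprime_6_prime[OF prime_p p5] coprime_mult_left_iff[of 2 3 "int p"] coprime_commute by simp
      ultimately have "int p dvd int l - int j" using dvd coprime_dvd_mult_right_iff by metis
      moreover have "int l - int j \<noteq> 0" using assms(2) k by auto
      ultimately have "int p \<le> \<bar>int l - int j\<bar>" by (intro zdvd_imp_le) auto
      then show False using assms k by auto
    qed
    have "val (of_int m) \<ge> 1" using False val_of_int[OF m] by simp
    then show ?thesis
      using \<open>odd k\<close> by (intro exp_recurrence_backward[OF p5 e(2) bdd_flat \<kappa> m _ rec]) auto
  qed
qed

section \<open>Inversion of the symmetric power\<close>

definition dual_coeff :: "nat \<Rightarrow> nat \<Rightarrow> 'a fps" where
  "dual_coeff j d = coeff (U' ^ (k - j) * V' ^ j) d"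

lemma subexp_dual_coeff: "subexp (dual_coeff j d)"
  unfolding dual_coeff_def U'_def V'_def
  by (intro subexp_linear_powers subexp_frame subexp_minus)

text \<open>The form U^(k-c) V^c is evaluated at (U', V') in two ways: coefficient by coefficient,
  and factor by factor, where the linear forms become the Wronskian and the Wronskian times the
  indeterminate.\<close>

lemma form_dual:
  assumes "c \<le> k"
  shows "(\<Sum>j\<le>k. dual_coeff j d * form_coeff k c j) = (if d = c then wronskian ^ k else 0)"
proof -
  have "(\<Sum>j\<le>k. Polynomial.smult (form_coeff k c j) (U' ^ (k - j) * V' ^ j)) =
      homogenize (k - c + c) (U ^ (k - c) * V ^ c) U' V'"
    using assms by (simp add: homogenize_def form_coeff_def)
  also have "\<dots> = (Polynomial.smult \<phi> U' + Polynomial.smult \<phi>' V') ^ (k - c)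
      * (Polynomial.smult \<psi> U' + Polynomial.smult \<psi>' V') ^ c"
    unfolding U_def V_def by (rule homogenize_linear_powers)
  also have "Polynomial.smult \<phi> U' + Polynomial.smult \<phi>' V' = [:wronskian:]"
    by (simp add: U'_def V'_def wronskian_def mult.commute)
  also have "Polynomial.smult \<psi> U' + Polynomial.smult \<psi>' V' = Polynomial.smult wronskian [:0, 1:]"
    by (simp add: U'_def V'_def wronskian_def mult.commute)
  also have "[:wronskian:] ^ (k - c) * Polynomial.smult wronskian [:0, 1:] ^ c =
      Polynomial.smult (wronskian ^ (k - c) * wronskian ^ c) ([:0, 1:] ^ c)"
  proof -
    have "[:a:] * Polynomial.smult b F = Polynomial.smult (a * b) F" for a b :: "'a fps" and F
      by (simp add: mult.commute)
    then show ?thesis by (simp only: poly_const_pow smult_power)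
  qed
  also have "wronskian ^ (k - c) * wronskian ^ c = wronskian ^ k"
    using assms by (simp flip: power_add)
  also have "[:0, 1:] ^ c = Polynomial.monom (1 :: 'a fps) c"
    by (simp add: monom_altdef)
  finally have "coeff (\<Sum>j\<le>k. Polynomial.smult (form_coeff k c j) (U' ^ (k - j) * V' ^ j)) d =
      (if d = c then wronskian ^ k else 0)" by simp
  then show ?thesis by (simp add: coeff_sum dual_coeff_def mult.commute)
qed

text \<open>The action is associative, so the two symmetric powers can be multiplied first. As the
  Wronskian is constant, inversion costs only a nonzero scalar.\<close>

lemma eta_from_flat:
  assumes "d \<le> k"
  shows "(3 * \<mu> / \<pi>) ^ k * \<eta> d n = (\<Sum>j\<le>k. act (dual_coeff j d) (flat j) n)"
proof -
  have "(\<Sum>j\<le>k. act (dual_coeff j d) (flat j) n) =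
      (\<Sum>j\<le>k. \<Sum>c\<le>k. act (dual_coeff j d) (act (form_coeff k c j) (\<eta> c)) n)"
    unfolding flat_def[abs_def]
    by (intro sum.cong refl act_sum_right[OF e(1)] subexp_dual_coeff bdd_act e(1) subexp_form_coeff bdd_eta)
  also have "\<dots> = (\<Sum>j\<le>k. \<Sum>c\<le>k. act (dual_coeff j d * form_coeff k c j) (\<eta> c) n)"
    by (intro sum.cong refl act_mult[OF e(1)] subexp_dual_coeff subexp_form_coeff bdd_eta)
  also have "\<dots> = (\<Sum>c\<le>k. \<Sum>j\<le>k. act (dual_coeff j d * form_coeff k c j) (\<eta> c) n)"
    by (rule sum.swap)
  also have "\<dots> = (\<Sum>c\<le>k. act (\<Sum>j\<le>k. dual_coeff j d * form_coeff k c j) (\<eta> c) n)"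
    by (intro sum.cong refl act_sum_left[OF e(1), symmetric] subexp_mult subexp_dual_coeff
        subexp_form_coeff bdd_eta)
  also have "\<dots> = (\<Sum>c\<le>k. if d = c then act (wronskian ^ k) (\<eta> c) n else 0)"
    by (intro sum.cong refl) (simp add: form_dual act_0_left[OF e(1)])
  also have "\<dots> = act (fps_const ((3 * \<mu> / \<pi>) ^ k)) (\<eta> d) n"
    using assms by (simp add: wronskian_eq fps_const_power)
  also have "\<dots> = (3 * \<mu> / \<pi>) ^ k * \<eta> d n"
    by (rule act_const[OF e(1) bdd_eta])
  finally show ?thesis ..
qed

lemma eta_zero:
  assumes "odd k \<or> k < 2 * p" and "k > 0" and "d \<le> k"
  shows "\<eta> d n = 0"
proof -
  have nz: "(3 * \<mu> / \<pi>) ^ k \<noteq> 0" using mu_nonzero pi_nonzero by simp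
  have "flat j m = 0" if "j \<le> k" for j m
  proof (cases "2 * j = k")
    case True
    \<comment> \<open>For 2 j = k the right-hand side of the recurrence is zero, which leaves only
      the index j.\<close>
    have off: "flat j m = 0" if "m \<noteq> int j" for m
    proof -
      have "int k - 2 * int j = 0" using True by simp
      then have "of_int (2 * m - int k) * flat j m = 0"
        using flat_recurrence[of m j] by (simp only: of_int_0 mult_zero_left mult_zero_right)
      moreover have "2 * m - int k \<noteq> 0" using that True by auto
      ultimately show ?thesis by (metis mult_eq_0_iff of_int_eq_0_iff)
    qed
    have null: "null_seq (\<lambda>l. fps_nth (dual_coeff j k) l * flat j (int j + 3 * int l))"
      by (rule act_null[OF e(1) subexp_dual_coeff bdd_flat])
    \<comment> \<open>The last coordinate is examined at j < k, where it vanishes by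
      \<open>eta_support\<close>. As \<open>flat i\<close> is zero for i \<noteq> j and
      \<open>flat j\<close> lives at j alone, just the term l = 0 survives.\<close>
    have "(3 * \<mu> / \<pi>) ^ k * \<eta> k (int j) = (\<Sum>i\<le>k. act (dual_coeff i k) (flat i) (int j))"
      by (rule eta_from_flat) simp
    also have "\<dots> = (\<Sum>i\<le>k. if i = j then act (dual_coeff i k) (flat i) (int j) else 0)"
    proof (intro sum.cong refl)
      fix i assume "i \<in> {..k}"
      then have "flat i = (\<lambda>n. 0)" if "i \<noteq> j"
        using that True assms(1) by (intro ext flat_zero) auto
      then show "act (dual_coeff i k) (flat i) (int j) =
          (if i = j then act (dual_coeff i k) (flat i) (int j) else 0)"
        using act_0_right[OF e(1)] by auto
    qed
    also have "\<dots> = act (dual_coeff j k) (flat j) (int j)" using \<open>j \<le> k\<close> by simp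
    also have "\<dots> = fps_nth (dual_coeff j k) 0 * flat j (int j) + vsum (\<lambda>l. 0)"
      unfolding act_def by (subst vsum_Suc[OF null]) (simp add: off)
    also have "vsum (\<lambda>l. 0) = 0" using act_0_left[OF e(1), of "\<lambda>_. 0" 0] by (simp add: act_def)
    finally have "fps_nth (dual_coeff j k) 0 * flat j (int j) = 0"
      using eta_support[of "int j" k] True assms(2) by simp
    \<comment> \<open>Coefficient k = 2 j is the top one of a product of two j-th powers of linear
      polynomials; \<phi> and \<phi>' have constant term 1.\<close>
    moreover have "dual_coeff j k = (- \<phi>') ^ j * \<phi> ^ j"
      using coeff_linear_powers_top[of "\<psi>'" "- \<phi>'" j "- \<psi>" \<phi> j] True
      unfolding dual_coeff_def U'_def V'_def by (simp add: mult_2 flip: True)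
    then have "fps_nth (dual_coeff j k) 0 = (- 1) ^ j"
      by (simp add: fps_nth_power_0)
    ultimately have "flat j (int j) = 0" by simp
    then show ?thesis using off by (cases "m = int j") auto
  qed (use assms that flat_zero in auto)
  then have "flat j = (\<lambda>n. 0)" if "j \<le> k" for j using that by auto
  then have "(\<Sum>j\<le>k. act (dual_coeff j d) (flat j) n) = 0"
    using act_0_right[OF e(1)] by (intro sum.neutral) auto
  then show ?thesis using eta_from_flat[OF assms(3), of n] nz by (metis mult_eq_0_iff)
qed

end

end

text \<open>Provides the root \<mu> of 27 \<mu>^2 = -4 \<pi>^2. Roots are postulated for polynomials
  over algebraic elements, and X^2 + 3 has rational coefficients.\<close>

lemma (in padic_complex_field) exists_sqrt_minus_3: "\<exists>s::'a. s\<^sup>2 = - 3"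
proof -
  have rat: "x \<in> algebraic_elements (valuation_closure ord \<rat>)" if "x \<in> \<rat>" for x :: 'a
  proof -
    have "\<rat> \<subseteq> valuation_closure ord (\<rat> :: 'a set)"
    proof
      fix y :: 'a assume "y \<in> \<rat>"
      moreover have "ord (y - y) \<ge> ereal M" for M using ord_eq_PInf_iff[of 0] by simp
      ultimately show "y \<in> valuation_closure ord \<rat>" unfolding valuation_closure_def by blast
    qed
    then have "coeff [:- x, 1:] i \<in> valuation_closure ord \<rat>" for i
      using that by (auto simp: coeff_pCons split: nat.split)
    then show ?thesis
      unfolding algebraic_elements_def poly_over_def by (intro CollectI exI[of _ "[:- x, 1:]"]) auto
  qed
  have "poly_over (algebraic_elements (valuation_closure ord \<rat>)) [:3, 0, 1 :: 'a:]"
    unfolding poly_over_def by (auto simp: coeff_pCons intro!: rat split: nat.split)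
  from algebraic_closure[OF this] obtain s :: 'a where "poly [:3, 0, 1:] s = 0" by auto
  then have "s\<^sup>2 = - 3" by (simp add: power2_eq_square add_eq_0_iff)
  then show ?thesis ..
qed

subsection \<open>Horizontal sections\<close>

text \<open>Nonzero entries lie next to the diagonal, so column c meets only the rows c - 1 and c +
  1; at c = 0 and c = k one of them is missing.\<close>

lemma partial_a_nth:
  fixes \<xi> :: "'a::field fps vec"
  assumes "\<xi> \<in> carrier_vec (k + 1)" and "c \<le> k"
  shows "vec_index (partial_a \<pi> k \<xi>) c = theta (vec_index \<xi> c)
    - ((if c = 0 then 0 else fps_const (of_nat (k - (c - 1)) * \<pi>) * fps_X * vec_index \<xi> (c - 1))
     + (if c = k then 0 else - (fps_const (of_nat (c + 1) * \<pi> / 3) * fps_X ^ 2) * vec_index \<xi> (c + 1)))"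
proof -
  define x where "x = vec_index \<xi>"
  have dim: "dim_vec \<xi> = k + 1" using assms(1) by simp
  have "vec_index (transpose_mat (G_mat \<pi> k) *\<^sub>v \<xi>) c = (\<Sum>r\<le>k. index_mat (G_mat \<pi> k) (r, c) * x r)"
    using assms(2) dim by (simp add: scalar_prod_def G_mat_def x_def atLeast0LessThan lessThan_Suc_atMost)
  also have "\<dots> = (\<Sum>r\<le>k. (if Suc r = c then fps_const (of_nat (k - r) * \<pi>) * fps_X * x r else 0)
      + (if r = c + 1 then - (fps_const (of_nat r * \<pi> / 3) * fps_X ^ 2) * x r else 0))"
    using assms(2) by (intro sum.cong refl) (auto simp: G_mat_def)
  also have "\<dots> = (if c = 0 then 0 else fps_const (of_nat (k - (c - 1)) * \<pi>) * fps_X * x (c - 1))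
      + (if c = k then 0 else - (fps_const (of_nat (c + 1) * \<pi> / 3) * fps_X ^ 2) * x (c + 1))"
    using assms(2) by (cases c) (auto simp: sum.distrib)
  finally show ?thesis
    using assms(2) dim by (simp add: partial_a_def theta_def x_def G_mat_def)
qed

text \<open>The coefficients of \<open>T\<^bsup>c\<^esup> x\<^sub>c(T\<^sup>2)\<close>.\<close>

definition stretch :: "(nat \<Rightarrow> 'a::zero fps) \<Rightarrow> nat \<Rightarrow> int \<Rightarrow> 'a" where
  "stretch x c n = (if n \<ge> int c \<and> even (n - int c) then fps_nth (x c) (nat ((n - int c) div 2)) else 0)"

text \<open>T d/dT is twice a d/da, whence the factors 2. Since T^c a = T^3 T^(c-1) and T^c a^2 =
  T^3 T^(c+1), both neighbours are shifted by the same 3.\<close>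

lemma stretch_ode:
  fixes x :: "nat \<Rightarrow> 'a::field_char_0 fps"
  assumes ode: "theta (x c) = fps_const \<alpha> * fps_X * x (c - 1) + - (fps_const \<beta> * fps_X ^ 2) * x (c + 1)"
    and \<alpha>: "c = 0 \<Longrightarrow> \<alpha> = 0"
  shows "of_int n * stretch x c n = of_nat c * stretch x c n
    + 2 * \<alpha> * stretch x (c - 1) (n - 3) - 2 * \<beta> * stretch x (c + 1) (n - 3)"
proof (cases "n \<ge> int c \<and> even (n - int c)")
  case True
  then obtain i where n: "n = int c + 2 * int i"
    by (metis evenE nat_0_le diff_ge_0_iff_ge diff_add_cancel add.commute zero_le_mult_iff zero_le_numeral
        not_numeral_le_zero)
  have eq: "of_nat i * fps_nth (x c) i =
      fps_nth (fps_const \<alpha> * fps_X * x (c - 1)) i - fps_nth (fps_const \<beta> * fps_X ^ 2 * x (c + 1)) i"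
    using arg_cong[OF ode, of "\<lambda>f. fps_nth f i"] by simp
  have 1: "fps_nth (fps_const \<alpha> * fps_X * x (c - 1)) i = \<alpha> * stretch x (c - 1) (n - 3)"
  \<comment> \<open>For c = 0 the truncated c - 1 is again 0, and \<alpha> = 0 removes the
    term.\<close>
  proof (cases "c = 0")
    case False
    then have n3: "n - 3 = int (c - 1) + 2 * (int i - 1)" by (simp add: n)
    show ?thesis
    proof (cases i)
      case 0
      then show ?thesis unfolding stretch_def n3 by (simp add: mult.assoc)
    next
      case (Suc l)
      then show ?thesis unfolding stretch_def n3 by (simp add: mult.assoc)
    qed
  qed (simp add: \<alpha>)
  \<comment> \<open>For i < 2 this index lies below the support of the neighbour, and both sides of
    the next claim vanish.\<close>
  have n3: "n - 3 = int (c + 1) + 2 * (int i - 2)" by (simp add: n)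
  have 2: "fps_nth (fps_const \<beta> * fps_X ^ 2 * x (c + 1)) i = \<beta> * stretch x (c + 1) (n - 3)"
  proof (cases "i < 2")
    case True
    then show ?thesis unfolding stretch_def n3
      by (simp add: mult.assoc fps_X_power_mult_nth)
  next
    case False
    then have "nat (int i - 2) = i - 2" by simp
    then show ?thesis using False unfolding stretch_def n3
      by (simp add: mult.assoc fps_X_power_mult_nth)
  qed
  have "stretch x c n = fps_nth (x c) i" unfolding n stretch_def by simp
  then have "of_int n * stretch x c n = of_nat c * stretch x c n + 2 * (of_nat i * fps_nth (x c) i)"
    by (simp add: n algebra_simps)
  then show ?thesis unfolding eq 1 2 by (simp add: algebra_simps)
next
  case False
  have "\<alpha> * stretch x (c - 1) (n - 3) = 0"
  proof (cases "c = 0")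
    case c: False
    then have "n - 3 - int (c - 1) = n - int c - 2" by simp
    then show ?thesis using False c unfolding stretch_def by auto
  qed (simp add: \<alpha>)
  moreover have "n - 3 - int (c + 1) = n - int c - 4" by simp
  then have "stretch x (c + 1) (n - 3) = 0" using False unfolding stretch_def by auto
  moreover have "stretch x c n = 0" using False unfolding stretch_def by (rule if_not_P)
  ultimately show ?thesis by (simp add: mult.assoc)
qed

text \<open>The substitution a = T^2 halves the slope 2 b' / 3. A smaller e is allowed because the
  sequence vanishes at negative indices.\<close>

lemma (in padic_complex_field) bdd_stretch:
  assumes "x c \<in> L_ring ord b'" and "e \<le> b' / 3"
  shows "bdd e (stretch x c)"
proof -
  obtain \<rho> where \<rho>: "\<And>i. vge (fps_nth (x c) i) (2 * b' / 3 * real i + \<rho>)"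
    using assms(1) unfolding L_ring_def vge_def by blast
  have "vge (stretch x c n) (e * real_of_int n + (\<rho> - e * real c))" for n
  proof (cases "n \<ge> int c \<and> even (n - int c)")
    case True
    define i where "i = nat ((n - int c) div 2)"
    have n: "n = int c + 2 * int i" using True by (auto simp: i_def)
    have "e * (2 * real i) \<le> b' / 3 * (2 * real i)" using assms(2) by (intro mult_right_mono) auto
    then have "e * real_of_int n + (\<rho> - e * real c) \<le> 2 * b' / 3 * real i + \<rho>"
      by (simp add: n algebra_simps)
    then show ?thesis using True vge_mono[OF \<rho>[of i]] by (simp add: stretch_def i_def)
  qed (auto simp: stretch_def)
  then show ?thesis unfolding bdd_def by blast
qed

theorem theorem6p1:
  fixes p k :: nat and ord :: "'a::field_char_0 \<Rightarrow> ereal" and \<pi> :: 'a and b b' :: real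
  assumes "prime p" and "p \<ge> 5"
    and "padic_complex_field p ord"
    and "\<pi> ^ (p - 1) = - of_nat p"
    and "(real p - 1) / real p \<ge> b" and "b > 1 / (real p - 1)"
    and "b / real p \<ge> b'" and "b' > 0"
    and "k > 0"
    and "odd k \<or> (even k \<and> k < 2 * p)"
  shows "H0 ord \<pi> b' k = {0\<^sub>v (k + 1)}"
proof -
  interpret padic_complex_field p ord by fact
  obtain s :: 'a where s: "s\<^sup>2 = - 3" using exists_sqrt_minus_3 by blast
  define \<mu> where "\<mu> = 2 * \<pi> * s / 9"
  have "27 * \<mu>\<^sup>2 = - 4 * \<pi>\<^sup>2"
    by (simp add: \<mu>_def power_mult_distrib power_divide s)
  then interpret airy_frame p ord \<pi> \<mu>
    by unfold_locales (use assms in auto)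
  have "\<xi> = 0\<^sub>v (k + 1)" if \<xi>: "\<xi> \<in> H0 ord \<pi> b' k" for \<xi>
  proof -
    have carrier: "\<xi> \<in> carrier_vec (k + 1)" and L: "\<And>j. j \<le> k \<Longrightarrow> vec_index \<xi> j \<in> L_ring ord b'"
      and ker: "partial_a \<pi> k \<xi> = 0\<^sub>v (k + 1)"
      using \<xi> by (auto simp: H0_def)
    \<comment> \<open>Extension by zero supplies the neighbour beyond k and keeps the decay bound
      valid for every c.\<close>
    define x where "x c = (if c \<le> k then vec_index \<xi> c else 0)" for c
    \<comment> \<open>b' / 3 is the decay that L(b') provides; 1 / 12 is what the backward
      recurrence tolerates.\<close>
    define e where "e = min (b' / 3) (1 / 12)"
    have xL: "x c \<in> L_ring ord b'" for c
      using L ord_eq_PInf_iff[of 0] by (auto simp: x_def L_ring_def)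
    have ode: "theta (x c) = fps_const (if c = 0 then 0 else of_nat (k - (c - 1)) * \<pi>) * fps_X * x (c - 1)
        + - (fps_const (if c = k then 0 else of_nat (c + 1) * \<pi> / 3) * fps_X ^ 2) * x (c + 1)"
      if "c \<le> k" for c
    proof -
      have "vec_index (partial_a \<pi> k \<xi>) c = 0" using that by (simp add: ker)
      then show ?thesis
        unfolding partial_a_nth[OF carrier that] using that by (auto simp: x_def)
    qed
    have "stretch x c n = 0" if "c \<le> k" for c n
    proof (rule eta_zero[of e "stretch x" k c n])
      show "of_int n * stretch x c n = of_nat c * stretch x c n
          + (if c = 0 then 0 else 2 * \<pi> * of_nat (k - (c - 1)) * stretch x (c - 1) (n - 3))
          - (if c = k then 0 else 2 * \<pi> / 3 * of_nat (c + 1) * stretch x (c + 1) (n - 3))"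
        if "c \<le> k" for c n
        by (subst stretch_ode[where x = x and c = c, OF ode[OF that]]) (auto simp: mult_ac)
      show "bdd e (stretch x c)" for c by (rule bdd_stretch[OF xL]) (simp add: e_def)
      show "stretch x c n = 0" if "n < int c" for c n using that by (simp add: stretch_def)
    qed (use assms that in \<open>auto simp: e_def\<close>)
    moreover have "stretch x c (int c + 2 * int i) = fps_nth (x c) i" for c i
      by (simp add: stretch_def)
    ultimately have "fps_nth (x c) i = 0" if "c \<le> k" for c i
      using that by metis
    then have "vec_index \<xi> c = 0" if "c \<le> k" for c
      using that by (intro fps_ext) (auto simp: x_def)
    then show ?thesis using carrier by (intro eq_vecI) auto
  qed
  moreover have "0\<^sub>v (k + 1) \<in> H0 ord \<pi> b' k"
  proof -
    have "partial_a \<pi> k (0\<^sub>v (k + 1)) = 0\<^sub>v (k + 1)"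
    proof (rule eq_vecI)
      fix c assume "c < dim_vec (0\<^sub>v (k + 1) :: 'a fps vec)"
      then have "c \<le> k" by simp
      then show "vec_index (partial_a \<pi> k (0\<^sub>v (k + 1))) c = vec_index (0\<^sub>v (k + 1)) c"
        by (subst partial_a_nth) auto
    qed (simp add: partial_a_def G_mat_def)
    then show ?thesis using ord_eq_PInf_iff[of 0] by (simp add: H0_def L_ring_def)
  qed
  ultimately show ?thesis by blast
qed

end
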